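(* Let $W:A^{\mathbb{Z}}\times\mathcal{B}^{\mathbb{Z}}\to\mathbb{C}$ be a stationary IMC cq-channel and $\varepsilon>0$. Then every code $\mathcal{C}_n=(u_i,b_i)_{i=1}^{M_n}$ of blocklength $n$ with $M_n\ge2^{n(C_{\mathrm{Holevo}}(W)+\varepsilon)}$ satisfies $$\bar e(\mathcal{C}_n)\ge1-\frac{C_{\mathrm{Holevo}}(W)+\frac1n}{C_{\mathrm{Holevo}}(W)+\varepsilon}.$$
   Context: $A$ finite, $\mathcal{B}=\mathcal{L}(\mathcal{H})$ with $\mathcal{H}$ finite-dimensional, $\mathcal{B}^{\mathbb{Z}}$ the quasi-local algebra, $\mathcal{B}^n=\mathcal{B}^{[1,n]}$. A cq-channel $W$: $x\mapsto W(x,b)$ Borel measurable, $b\mapsto W(x,b)$ a state. Stationary: $W(T_{in}x,b)=W(x,T_{out}b)$. IMC: causal ($W(x,b)=W(\tilde x,b)$ for $b$ in the algebra of sites $\le n$ whenever $x_i=\tilde x_i$, $i\le n$) and input memoryless (same for sites $\ge n$ and $x_i=\tilde x_i$, $i\ge n$); then $W^n(x^n,\cdot)$ is a state on $\mathcal{B}^n$ with density $D_{x^n}$. A code $(u_i,b_i)_{i=1}^M$: $u_i\in A^n$, $0\le b_i\in\mathcal{B}^n$, $\sum b_i\le\mathbf{1}$. Average error $\bar e(\mathcal{C})=\frac1M\sum_{i=1}^M\sup_{x\in[u_i]}(1-W(x,b_i))$ ($[u_i]$ the cylinder set). $\chi(p^n,W^n)=S(\sum p^n(x^n)D_{x^n})-\sum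 p^n(x^n)S(D_{x^n})$, $S(D)=-\mathrm{tr}D\log D$, $C_n(W)=\max_{p^n}\chi(p^n,W^n)$, $C_{\mathrm{Holevo}}(W)=\lim_n\frac1nC_n(W)=\sup_n\frac1nC_n(W)$. Logs base 2. *)

theory Defs
  imports "HOL-Analysis.Analysis" "HOL-Probability.Probability"
    "Jordan_Normal_Form.Char_Poly" "Jordan_Normal_Form.Conjugate"
begin

text \<open>Conventions.  H = C^d.  A local operator on the d sites m, m+1, ..., m+k-1
 of the quasi-local algebra B^Z is a (d^k x d^k) complex matrix; the basis index is
 the base-d number whose most significant digit belongs to site m.\<close>

definition mtrace :: "complex mat \<Rightarrow> complex" where
  "mtrace M = (\<Sum>i<dim_row M. M $$ (i,i))"

definition psd :: "nat \<Rightarrow> complex mat \<Rightarrow> bool" where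
  "psd N M \<longleftrightarrow> M \<in> carrier_mat N N \<and>
     (\<forall>v \<in> carrier_vec N. Im (scalar_prod (conjugate v) (M *\<^sub>v v)) = 0 \<and> Re (scalar_prod (conjugate v) (M *\<^sub>v v)) \<ge> 0)"

definition ptrace_last :: "nat \<Rightarrow> nat \<Rightarrow> complex mat \<Rightarrow> complex mat" where
  "ptrace_last d D M = mat D D (\<lambda>(i,j). \<Sum>k<d. M $$ (i*d+k, j*d+k))"

definition ptrace_first :: "nat \<Rightarrow> nat \<Rightarrow> complex mat \<Rightarrow> complex mat" where
  "ptrace_first d D M = mat D D (\<lambda>(i,j). \<Sum>k<d. M $$ (k*D+i, k*D+j))"

text \<open>A state on the quasi-local algebra B^Z, given by its consistent family of local
 density matrices: rho m k is the density matrix of the restriction to the sites m..m+k-1.\<close>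
definition quasi_local_state :: "nat \<Rightarrow> (int \<Rightarrow> nat \<Rightarrow> complex mat) \<Rightarrow> bool" where
  "quasi_local_state d rho \<longleftrightarrow>
     (\<forall>m k. psd (d^k) (rho m k) \<and> mtrace (rho m k) = 1) \<and>
     (\<forall>m k. ptrace_last d (d^k) (rho m (Suc k)) = rho m k \<and>
            ptrace_first d (d^k) (rho m (Suc k)) = rho (m+1) k)"

text \<open>cq-channel: W x is a state on B^Z for every input sequence x, and x \<mapsto> W(x,b)
 is Borel measurable (product sigma algebra on A^Z = Borel sets of the product topology).\<close>
definition cq_channel :: "nat \<Rightarrow> ((int \<Rightarrow> 'a) \<Rightarrow> int \<Rightarrow> nat \<Rightarrow> complex mat) \<Rightarrow> bool" where
  "cq_channel d W \<longleftrightarrow> (\<forall>x. quasi_local_state d (W x)) \<and>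
     (\<forall>m k i j. i < d^k \<longrightarrow> j < d^k \<longrightarrow>
        (\<lambda>x. W x m k $$ (i,j)) \<in> borel_measurable (Pi\<^sub>M UNIV (\<lambda>_. count_space UNIV)))"

definition stationary :: "((int \<Rightarrow> 'a) \<Rightarrow> int \<Rightarrow> nat \<Rightarrow> complex mat) \<Rightarrow> bool" where
  "stationary W \<longleftrightarrow> (\<forall>x m k. W (\<lambda>i. x (i+1)) m k = W x (m+1) k)"

definition causal :: "((int \<Rightarrow> 'a) \<Rightarrow> int \<Rightarrow> nat \<Rightarrow> complex mat) \<Rightarrow> bool" where
  "causal W \<longleftrightarrow> (\<forall>n x x'. (\<forall>i\<le>n. x i = x' i) \<longrightarrow>
      (\<forall>m k. m + int k - 1 \<le> n \<longrightarrow> W x m k = W x' m k))"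

definition input_memoryless :: "((int \<Rightarrow> 'a) \<Rightarrow> int \<Rightarrow> nat \<Rightarrow> complex mat) \<Rightarrow> bool" where
  "input_memoryless W \<longleftrightarrow> (\<forall>n x x'. (\<forall>i\<ge>n. x i = x' i) \<longrightarrow>
      (\<forall>m k. m \<ge> n \<longrightarrow> W x m k = W x' m k))"

definition IMC :: "((int \<Rightarrow> 'a) \<Rightarrow> int \<Rightarrow> nat \<Rightarrow> complex mat) \<Rightarrow> bool" where
  "IMC W \<longleftrightarrow> causal W \<and> input_memoryless W"

definition words :: "nat \<Rightarrow> 'a list set" where
  "words n = {xs. length xs = n}"

definition cyl :: "'a list \<Rightarrow> (int \<Rightarrow> 'a) set" where
  "cyl u = {x. \<forall>j<length u. x (int j + 1) = u ! j}"

text \<open>density D_{x^n} of W^n(x^n,.) on B^n = B^{[1,n]} (well defined for IMC channels)\<close>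
definition block_density :: "((int \<Rightarrow> 'a) \<Rightarrow> int \<Rightarrow> nat \<Rightarrow> complex mat) \<Rightarrow> nat \<Rightarrow> 'a list \<Rightarrow> complex mat" where
  "block_density W n xs = W (\<lambda>i. if 1 \<le> i \<and> i \<le> int n then xs ! nat (i-1) else undefined) 1 n"

text \<open>von Neumann entropy S(D) = -tr D log D (base 2) = - sum over eigenvalues
 (with algebraic multiplicity) of lambda log lambda, with 0 log 0 = 0\<close>
definition eta :: "real \<Rightarrow> real" where
  "eta t = (if t \<le> 0 then 0 else t * log 2 t)"

definition vN_entropy :: "complex mat \<Rightarrow> real" where
  "vN_entropy D = - (\<Sum>z\<in>{z. poly (char_poly D) z = 0}.
        real (order z (char_poly D)) * eta (Re z))"

definition is_distr :: "nat \<Rightarrow> ('a list \<Rightarrow> real) \<Rightarrow> bool" where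
  "is_distr n p \<longleftrightarrow> (\<forall>xs. p xs \<ge> 0) \<and> (\<Sum>xs\<in>words n. p xs) = 1"

definition holevo_chi :: "nat \<Rightarrow> ((int \<Rightarrow> 'a) \<Rightarrow> int \<Rightarrow> nat \<Rightarrow> complex mat) \<Rightarrow> nat \<Rightarrow> ('a list \<Rightarrow> real) \<Rightarrow> real" where
  "holevo_chi d W n p =
     vN_entropy (Matrix.mat (d^n) (d^n) (\<lambda>(i,j). \<Sum>xs\<in>words n. complex_of_real (p xs) * block_density W n xs $$ (i,j)))
     - (\<Sum>xs\<in>words n. p xs * vN_entropy (block_density W n xs))"

text \<open>C_n(W) = max_{p^n} chi(p^n, W^n)  (the maximum is attained, so it equals the supremum)\<close>
definition C_n :: "nat \<Rightarrow> ((int \<Rightarrow> 'a::finite) \<Rightarrow> int \<Rightarrow> nat \<Rightarrow> complex mat) \<Rightarrow> nat \<Rightarrow> real" where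
  "C_n d W n = Sup {holevo_chi d W n p | p. is_distr n p}"

text \<open>C_Holevo(W) = sup_n C_n(W)/n  (= lim_n C_n(W)/n)\<close>
definition C_Holevo :: "nat \<Rightarrow> ((int \<Rightarrow> 'a::finite) \<Rightarrow> int \<Rightarrow> nat \<Rightarrow> complex mat) \<Rightarrow> real" where
  "C_Holevo d W = (SUP n\<in>{1..}. C_n d W n / real n)"

definition is_code :: "nat \<Rightarrow> nat \<Rightarrow> nat \<Rightarrow> (nat \<Rightarrow> 'a list) \<Rightarrow> (nat \<Rightarrow> complex mat) \<Rightarrow> bool" where
  "is_code d n M u b \<longleftrightarrow> (\<forall>i<M. length (u i) = n \<and> psd (d^n) (b i)) \<and>
     psd (d^n) (1\<^sub>m (d^n) - Matrix.mat (d^n) (d^n) (\<lambda>(r,c). \<Sum>i<M. b i $$ (r,c)))"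

definition avg_error :: "((int \<Rightarrow> 'a) \<Rightarrow> int \<Rightarrow> nat \<Rightarrow> complex mat) \<Rightarrow> nat \<Rightarrow> nat \<Rightarrow> (nat \<Rightarrow> 'a list) \<Rightarrow> (nat \<Rightarrow> complex mat) \<Rightarrow> real" where
  "avg_error W n M u b = (1 / real M) * (\<Sum>i<M. SUP x\<in>cyl (u i). 1 - Re (mtrace (W x 1 n * b i)))"

end

theory Submission
  imports Defs "Jordan_Normal_Form.Schur_Decomposition" "HOL-Real_Asymp.Real_Asymp"
begin

text \<open>Let \<open>P\<close> be the average success probability, \<open>D\<^sub>m\<close> the output density of the \<open>m\<close>-th codeword and
  \<open>\<sigma>\<close> the average of the \<open>D\<^sub>m\<close>. Everything follows from \<open>P log M - 1 \<le> \<chi>\<close>, where \<open>\<chi>\<close> belongs to the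
  empirical distribution of the codewords. This is data processing of the relative entropy of
  \<open>\<Oplus> D\<^sub>m / M\<close> with respect to \<open>\<Oplus> \<sigma> / M\<close> under the binary test \<open>\<Oplus> b\<^sub>m\<close>, which accepts the first state
  with probability \<open>P\<close> and the second with probability at most \<open>1 / M\<close>. With eigenvalues \<open>r\<^sub>i\<close>, \<open>s\<^sub>j\<close>
  and eigenvectors \<open>e\<^sub>i\<close>, \<open>f\<^sub>j\<close> of two density matrices, the relative entropy is
  \<open>\<Sum> |<e\<^sub>i, f\<^sub>j>|\<^sup>2 r\<^sub>i ln (r\<^sub>i / s\<^sub>j)\<close>, the integral over \<open>t > 0\<close> of the (regularised) resolvent sums
  \<open>\<Sum> |<e\<^sub>i, f\<^sub>j>|\<^sup>2 r\<^sub>i\<^sup>2 / (s\<^sub>j + t r\<^sub>i)\<close>. Each of these is a supremum of quadratic expressions in an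
  operator \<open>X\<close>, so restricting \<open>X\<close> to combinations of the test and its complement gives the
  classical quantity as a lower bound.\<close>

subsection \<open>Spectral decomposition of Hermitian matrices\<close>

text \<open>A vector is a function of which only the values below \<open>N\<close> matter. Vectors
  are therefore compared pointwise below \<open>N\<close>, and rewriting inside a form goes through
  \<open>ip_cong\<close> and \<open>mv_cong\<close>.\<close>

definition ip :: "nat \<Rightarrow> (nat \<Rightarrow> complex) \<Rightarrow> (nat \<Rightarrow> complex) \<Rightarrow> complex" where
  "ip N v w = (\<Sum>k<N. cnj (v k) * w k)"

definition mv :: "nat \<Rightarrow> complex mat \<Rightarrow> (nat \<Rightarrow> complex) \<Rightarrow> nat \<Rightarrow> complex" where
  "mv N A v k = (\<Sum>l<N. A $$ (k,l) * v l)"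

definition hermitian :: "nat \<Rightarrow> complex mat \<Rightarrow> bool" where
  "hermitian N A \<longleftrightarrow> A \<in> carrier_mat N N \<and> (\<forall>i<N. \<forall>j<N. A $$ (j,i) = cnj (A $$ (i,j)))"

definition orthonormal :: "nat \<Rightarrow> nat \<Rightarrow> (nat \<Rightarrow> nat \<Rightarrow> complex) \<Rightarrow> bool" where
  "orthonormal N k E \<longleftrightarrow> (\<forall>i<k. \<forall>j<k. ip N (E i) (E j) = of_bool (i = j))"

lemma cnj_ip: "cnj (ip N v w) = ip N w v"
  by (simp add: ip_def mult.commute)

lemma ip_cong: "(\<And>k. k < N \<Longrightarrow> v k = v' k) \<Longrightarrow> (\<And>k. k < N \<Longrightarrow> w k = w' k) \<Longrightarrow> ip N v w = ip N v' w'"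
  by (simp add: ip_def)

lemma ip_add_right: "ip N v (\<lambda>k. w k + w' k) = ip N v w + ip N v w'"
  by (simp add: ip_def algebra_simps sum.distrib)

lemma ip_add_left: "ip N (\<lambda>k. v k + v' k) w = ip N v w + ip N v' w"
  by (simp add: ip_def algebra_simps sum.distrib)

lemma ip_scale_right: "ip N v (\<lambda>k. c * w k) = c * ip N v w"
  by (simp add: ip_def sum_distrib_left algebra_simps)

lemma ip_scale_left: "ip N (\<lambda>k. c * v k) w = cnj c * ip N v w"
  by (simp add: ip_def sum_distrib_left algebra_simps)

lemma ip_sum_right: "ip N v (\<lambda>k. \<Sum>i\<in>I. w i k) = (\<Sum>i\<in>I. ip N v (w i))"
  unfolding ip_def sum_distrib_left by (rule sum.swap)

lemma mv_add: "mv N A (\<lambda>l. v l + w l) = (\<lambda>k. mv N A v k + mv N A w k)"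
  by (rule ext) (simp add: mv_def algebra_simps sum.distrib)

lemma mv_scale: "mv N A (\<lambda>l. c * v l) = (\<lambda>k. c * mv N A v k)"
  by (rule ext) (simp add: mv_def sum_distrib_left algebra_simps)

lemma mv_cong: "(\<And>k. k < N \<Longrightarrow> v k = v' k) \<Longrightarrow> mv N A v k = mv N A v' k"
  by (simp add: mv_def)

lemma ip_self: "ip N v v = of_real (\<Sum>k<N. (cmod (v k))\<^sup>2)"
  by (simp add: ip_def complex_norm_square[symmetric] mult.commute del: of_real_power)

lemma ip_self_eq_0: "ip N v v = 0 \<Longrightarrow> k < N \<Longrightarrow> v k = 0"
  unfolding ip_self of_real_eq_0_iff by (subst (asm) sum_nonneg_eq_0_iff) auto

lemma hermitian_cnj: "hermitian N A \<Longrightarrow> i < N \<Longrightarrow> j < N \<Longrightarrow> cnj (A $$ (i,j)) = A $$ (j,i)"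
  unfolding hermitian_def by metis

lemma hermitian_ip:
  assumes "hermitian N A"
  shows "ip N (mv N A v) w = ip N v (mv N A w)"
proof -
  have "ip N (mv N A v) w = (\<Sum>k<N. \<Sum>l<N. cnj (v l) * (A $$ (l,k) * w k))"
    unfolding ip_def mv_def
    by (intro sum.cong refl) (simp add: sum_distrib_left sum_distrib_right hermitian_cnj[OF assms] mult_ac)
  also have "\<dots> = ip N v (mv N A w)"
    unfolding ip_def mv_def sum_distrib_left by (rule sum.swap)
  finally show ?thesis .
qed

lemma mult_mat_vec_index:
  assumes "A \<in> carrier_mat N N" "v \<in> carrier_vec N" "k < N"
  shows "vec_index (A *\<^sub>v v) k = mv N A (vec_index v) k"
  using assms by (auto simp: mv_def scalar_prod_def atLeast0LessThan intro!: sum.cong)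

lemma psd_iff:
  "psd N A \<longleftrightarrow> A \<in> carrier_mat N N \<and>
     (\<forall>v. Im (ip N v (mv N A v)) = 0 \<and> Re (ip N v (mv N A v)) \<ge> 0)"
proof -
  have *: "scalar_prod (conjugate v) (A *\<^sub>v v) = ip N (vec_index v) (mv N A (vec_index v))"
    if "A \<in> carrier_mat N N" "v \<in> carrier_vec N" for v
    using that unfolding scalar_prod_def ip_def
    by (auto simp: atLeast0LessThan mult_mat_vec_index[symmetric] intro!: sum.cong simp del: index_mult_mat_vec)
  have **: "ip N (vec_index (Matrix.vec N v)) (mv N A (vec_index (Matrix.vec N v))) = ip N v (mv N A v)" for v
    by (intro ip_cong mv_cong) auto
  show ?thesis
    unfolding psd_def using * ** by (metis vec_carrier)
qed

lemma psd_carrier: "psd N A \<Longrightarrow> A \<in> carrier_mat N N"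
  by (simp add: psd_def)

lemma psd_real: "psd N A \<Longrightarrow> ip N v (mv N A v) = of_real (Re (ip N v (mv N A v)))"
  by (simp add: psd_iff complex_eq_iff)

text \<open>Polarisation: a form that takes only real values is Hermitian. It is tested on the
  vectors \<open>e i + c * e j\<close>.\<close>

lemma psd_hermitian:
  assumes "psd N A"
  shows "hermitian N A"
  unfolding hermitian_def
proof (intro conjI allI impI)
  show "A \<in> carrier_mat N N" using assms by (rule psd_carrier)
  fix i j assume ij: "i < N" "j < N"
  define e :: "nat \<Rightarrow> nat \<Rightarrow> complex" where "e i k = of_bool (k = i)" for i k
  have ee: "ip N (e k) (mv N A (e l)) = A $$ (k,l)" if "k < N" "l < N" for k l
    using that by (simp add: ip_def mv_def e_def of_bool_def if_distrib[of cnj] if_distrib[of "\<lambda>x. x * _"] if_distrib[of "\<lambda>x. _ * x"] cong: if_cong)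
  have q: "ip N (\<lambda>k. e i k + c * e j k) (mv N A (\<lambda>k. e i k + c * e j k))
     = A $$ (i,i) + c * A $$ (i,j) + cnj c * A $$ (j,i) + cnj c * c * A $$ (j,j)" for c
    by (simp add: mv_add mv_scale ip_add_left ip_add_right ip_scale_left ip_scale_right ee ij algebra_simps)
  have im: "Im (A $$ (i,i) + c * A $$ (i,j) + cnj c * A $$ (j,i) + cnj c * c * A $$ (j,j)) = 0" for c
    using assms unfolding q[symmetric] psd_iff by blast
  have im0: "Im (A $$ (k,k)) = 0" if "k < N" for k
    using assms that unfolding psd_iff by (metis ee)
  \<comment> \<open>\<open>c = 1\<close> makes the imaginary parts of the two entries opposite,
    \<open>c = \<i>\<close> makes their real parts equal.\<close>
  show "A $$ (j,i) = cnj (A $$ (i,j))"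
    using im[of 1] im[of \<i>] im0[of i] im0[of j] ij by (simp add: complex_eq_iff)
qed

section \<open>Traces and orthonormal eigenvectors\<close>

lemma mtrace_mult_comm:
  assumes "A \<in> carrier_mat n m" "B \<in> carrier_mat m n"
  shows "mtrace (A * B) = mtrace (B * A)"
proof -
  have "mtrace (A * B) = (\<Sum>i<n. \<Sum>k<m. A $$ (i,k) * B $$ (k,i))"
    using assms by (auto simp: mtrace_def scalar_prod_def atLeast0LessThan intro!: sum.cong)
  also have "\<dots> = (\<Sum>k<m. \<Sum>i<n. B $$ (k,i) * A $$ (i,k))"
    by (subst sum.swap) (simp add: mult.commute)
  also have "\<dots> = mtrace (B * A)"
    using assms by (auto simp: mtrace_def scalar_prod_def atLeast0LessThan intro!: sum.cong)
  finally show ?thesis .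
qed

text \<open>Schur triangulation is a similarity, which keeps the trace, and the diagonal of the
  triangular factor is the list \<open>as\<close>.\<close>

lemma mtrace_eq_sum_eigenvalues:
  assumes A: "A \<in> carrier_mat N N" and as: "char_poly A = (\<Prod>a\<leftarrow>as. [:- a, 1:])"
  shows "mtrace A = sum_list as"
proof -
  obtain B P Q where s: "schur_decomposition A as = (B, P, Q)"
    by (metis prod_cases3)
  have w: "similar_mat_wit A B P Q" and d: "diag_mat B = as"
    using schur_decomposition[OF A as s] by auto
  note D = similar_mat_witD2[OF A w]
  have "mtrace A = mtrace (P * (B * Q))" using D by (simp add: assoc_mult_mat[of _ N N _ N _ N])
  also have "\<dots> = mtrace ((B * Q) * P)" using D by (intro mtrace_mult_comm) auto
  also have "(B * Q) * P = B * (Q * P)" using D by (simp add: assoc_mult_mat[of _ N N _ N _ N])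
  also have "\<dots> = B" using D by simp
  also have "mtrace B = sum_list as"
    using D unfolding d[symmetric] by (simp add: diag_mat_def mtrace_def interv_sum_list_conv_sum_set_nat atLeast0LessThan)
  finally show ?thesis .
qed

text \<open>The known eigenvectors are moved to a common eigenvalue \<open>\<mu>\<close>, chosen so that not all
  eigenvalues of the shifted matrix can equal \<open>\<mu>\<close>; an eigenvector for another eigenvalue is then
  orthogonal to the old ones.\<close>

lemma hermitian_extend_eigenvectors:
  fixes lam :: "nat \<Rightarrow> real" and V :: "nat \<Rightarrow> nat \<Rightarrow> complex"
  assumes A: "hermitian N A" and "k < N" and on: "orthonormal N k V"
    and ev: "\<And>i l. i < k \<Longrightarrow> l < N \<Longrightarrow> mv N A (V i) l = lam i * V i l"
  shows "\<exists>(v :: nat \<Rightarrow> complex) (\<nu>::real). (\<forall>i<k. ip N (V i) v = 0) \<and> ip N v v = 1 \<and> (\<forall>l<N. mv N A v l = \<nu> * v l)"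
proof -
  \<comment> \<open>\<open>c\<close> is what the trace of \<open>A\<close> leaves for the missing
    \<open>N - k\<close> eigenvalues. If the shifted matrix had no eigenvalue but
    \<open>\<mu>\<close>, its trace \<open>c + k * \<mu>\<close> would be \<open>N * \<mu>\<close>;
    the choice \<open>(N - k) * \<mu> = c + 1\<close> excludes this.\<close>
  define c where "c = Re (mtrace A) - (\<Sum>i<k. lam i)"
  define \<mu> where "\<mu> = (c + 1) / (real N - real k)"
  have \<mu>: "(real N - real k) * \<mu> \<noteq> c" using \<open>k < N\<close> by (simp add: \<mu>_def)
  \<comment> \<open>\<open>A'\<close> sends each \<open>V i\<close> to \<open>\<mu> * V i\<close>
    and agrees with \<open>A\<close> on the vectors orthogonal to all of them.\<close>
  define A' where "A' = Matrix.mat N N (\<lambda>(a,b). A $$ (a,b) + (\<Sum>i<k. of_real (\<mu> - lam i) * V i a * cnj (V i b)))"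
  have A': "A' \<in> carrier_mat N N" by (simp add: A'_def)
  have Ac: "A \<in> carrier_mat N N" using A by (simp add: hermitian_def)
  have h': "hermitian N A'"
    unfolding hermitian_def by (auto simp: A'_def hermitian_cnj[OF A] mult_ac)
  have mv': "mv N A' f l = mv N A f l + (\<Sum>i<k. of_real (\<mu> - lam i) * ip N (V i) f * V i l)" if "l < N" for f l
  proof -
    have "mv N A' f l = mv N A f l + (\<Sum>b<N. \<Sum>i<k. of_real (\<mu> - lam i) * V i l * cnj (V i b) * f b)"
      using that by (simp add: mv_def A'_def ring_distribs sum.distrib sum_distrib_right)
    also have "(\<Sum>b<N. \<Sum>i<k. of_real (\<mu> - lam i) * V i l * cnj (V i b) * f b)
        = (\<Sum>i<k. \<Sum>b<N. of_real (\<mu> - lam i) * V i l * cnj (V i b) * f b)" by (rule sum.swap)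
    also have "\<dots> = (\<Sum>i<k. of_real (\<mu> - lam i) * ip N (V i) f * V i l)"
      by (simp add: ip_def sum_distrib_left sum_distrib_right mult_ac)
    finally show ?thesis .
  qed
  have "mtrace A' = mtrace A + (\<Sum>a<N. \<Sum>i<k. of_real (\<mu> - lam i) * V i a * cnj (V i a))"
    using Ac \<open>k < N\<close> by (auto simp: mtrace_def A'_def sum.distrib)
  also have "(\<Sum>a<N. \<Sum>i<k. of_real (\<mu> - lam i) * V i a * cnj (V i a)) = (\<Sum>i<k. of_real (\<mu> - lam i) * ip N (V i) (V i))"
    by (subst sum.swap) (simp add: ip_def sum_distrib_left mult_ac)
  also have "\<dots> = (\<Sum>i<k. of_real (\<mu> - lam i))"
    using on by (simp add: orthonormal_def)
  finally have tr: "Re (mtrace A') = c + real k * \<mu>"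
    by (simp add: c_def sum_subtractf)
  obtain as where as: "char_poly A' = (\<Prod>a\<leftarrow>as. [:- a, 1:])" "length as = N"
    using char_poly_factorized[OF A'] by blast
  have "\<exists>\<nu>\<in>set as. \<nu> \<noteq> of_real \<mu>"
  proof (rule ccontr)
    assume "\<not> ?thesis"
    hence "as = replicate N (of_real \<mu>)" using as(2) by (metis replicate_eqI)
    hence "Re (mtrace A') = real N * \<mu>"
      using mtrace_eq_sum_eigenvalues[OF A' as(1)] by (simp add: sum_list_replicate)
    thus False using tr \<mu> by (simp add: algebra_simps)
  qed
  then obtain \<nu> where \<nu>: "\<nu> \<in> set as" "\<nu> \<noteq> of_real \<mu>" by blast
  have "poly (char_poly A') \<nu> = 0"
    using \<nu>(1) unfolding as(1) poly_prod_list prod_list_zero_iff by (auto simp: image_iff intro!: bexI[of _ \<nu>])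
  hence "eigenvalue A' \<nu>" using eigenvalue_root_char_poly[OF A'] by blast
  then obtain w where w: "w \<in> carrier_vec N" "w \<noteq> 0\<^sub>v N" "A' *\<^sub>v w = \<nu> \<cdot>\<^sub>v w"
    using A' by (auto simp: eigenvalue_def eigenvector_def)
  define f where "f = vec_index w"
  have fe: "mv N A' f l = \<nu> * f l" if "l < N" for l
    using mult_mat_vec_index[OF A' w(1) that] w(1,3) that by (simp add: f_def)
  have fne: "ip N f f \<noteq> 0"
  proof
    assume "ip N f f = 0"
    hence "f l = 0" if "l < N" for l using ip_self_eq_0 that by blast
    hence "w = 0\<^sub>v N" using w(1) by (intro eq_vecI) (auto simp: f_def)
    thus False using w(2) by blast
  qed
  have orth: "ip N (V i) f = 0" if i: "i < k" for i
  proof -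
    have e: "mv N A' (V i) l = \<mu> * V i l" if "l < N" for l
    proof -
      have "mv N A' (V i) l = lam i * V i l + (\<Sum>j<k. if j = i then of_real (\<mu> - lam j) * V j l else 0)"
        unfolding mv'[OF that] ev[OF i that] using on i
        by (intro arg_cong2[of _ _ _ _ "(+)"] sum.cong) (auto simp: orthonormal_def)
      also have "\<dots> = \<mu> * V i l" using i by (simp add: algebra_simps)
      finally show ?thesis .
    qed
    have "\<mu> * ip N (V i) f = ip N (mv N A' (V i)) f"
      by (subst ip_cong[OF e refl], assumption) (simp add: ip_scale_left)
    also have "\<dots> = ip N (V i) (mv N A' f)" by (rule hermitian_ip[OF h'])
    also have "\<dots> = \<nu> * ip N (V i) f"
      by (subst ip_cong[OF refl fe], assumption) (simp add: ip_scale_right)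
    finally show ?thesis using \<nu>(2) by simp
  qed
  \<comment> \<open>The correction in \<open>A'\<close> vanishes on \<open>f\<close>, which is
    orthogonal to every \<open>V i\<close>.\<close>
  have fA: "mv N A f l = \<nu> * f l" if "l < N" for l
    using mv'[OF that, of f] fe[OF that] orth by simp
  have "cnj \<nu> * ip N f f = ip N (mv N A f) f"
    by (subst ip_cong[OF fA refl], assumption) (simp add: ip_scale_left)
  also have "\<dots> = ip N f (mv N A f)" by (rule hermitian_ip[OF A])
  also have "\<dots> = \<nu> * ip N f f"
    by (subst ip_cong[OF refl fA], assumption) (simp add: ip_scale_right)
  finally have "cnj \<nu> = \<nu>" using fne by simp
  hence \<nu>r: "\<nu> = of_real (Re \<nu>)" by (simp add: complex_eq_iff)
  define s where "s = (\<Sum>k<N. (cmod (f k))\<^sup>2)"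
  have s: "ip N f f = of_real s" by (simp add: ip_self s_def)
  have "s \<noteq> 0" using fne s by auto
  moreover have "s \<ge> 0" unfolding s_def by (intro sum_nonneg) simp
  ultimately have "s > 0" by simp
  define v where "v = (\<lambda>l. of_real (1 / sqrt s) * f l)"
  have "ip N v v = of_real (1 / sqrt s * (1 / sqrt s) * s)"
    unfolding v_def ip_scale_left ip_scale_right s
    by (simp only: of_real_mult complex_cnj_complex_of_real mult.assoc)
  also have "1 / sqrt s * (1 / sqrt s) * s = 1" using \<open>s > 0\<close> by (simp add: field_simps)
  finally have "ip N v v = 1" by simp
  moreover have "ip N (V i) v = 0" if "i < k" for i
    using orth[OF that] unfolding v_def ip_scale_right by simp
  moreover have "mv N A v l = of_real (Re \<nu>) * v l" if "l < N" for l
    using fA[OF that] unfolding v_def mv_scale \<nu>r[symmetric] by simp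
  ultimately show ?thesis by blast
qed

lemma hermitian_eigenvectors:
  assumes A: "hermitian N A" and "k \<le> N"
  shows "\<exists>(V :: nat \<Rightarrow> nat \<Rightarrow> complex) (lam::nat \<Rightarrow> real). orthonormal N k V \<and> (\<forall>i<k. \<forall>l<N. mv N A (V i) l = lam i * V i l)"
  using \<open>k \<le> N\<close>
proof (induction k)
  case 0
  show ?case by (auto simp: orthonormal_def)
next
  case (Suc k)
  then obtain V :: "nat \<Rightarrow> nat \<Rightarrow> complex" and lam :: "nat \<Rightarrow> real" where V: "orthonormal N k V" "\<And>i l. i < k \<Longrightarrow> l < N \<Longrightarrow> mv N A (V i) l = lam i * V i l"
    by auto
  obtain v :: "nat \<Rightarrow> complex" and \<nu> :: real where v: "\<And>i. i < k \<Longrightarrow> ip N (V i) v = 0" "ip N v v = 1" "\<And>l. l < N \<Longrightarrow> mv N A v l = \<nu> * v l"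
    using hermitian_extend_eigenvectors[OF A _ V] Suc.prems by auto
  have v': "ip N v (V i) = 0" if "i < k" for i
    using v(1)[OF that] cnj_ip[of N "V i" v] by simp
  show ?case
    using V v v'
    by (intro exI[of _ "V(k := v)"] exI[of _ "lam(k := \<nu>)"]) (auto simp: orthonormal_def less_Suc_eq)
qed

section \<open>Orthonormal bases and spectral decompositions\<close>

lemma orthonormal_complete:
  assumes "orthonormal N N E" "k < N" "l < N"
  shows "(\<Sum>i<N. E i k * cnj (E i l)) = of_bool (k = l)"
proof -
  define U where "U = Matrix.mat N N (\<lambda>(k,i). E i k)"
  define U' where "U' = Matrix.mat N N (\<lambda>(i,k). cnj (E i k))"
  have c: "U \<in> carrier_mat N N" "U' \<in> carrier_mat N N" by (auto simp: U_def U'_def)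
  have "U' * U = 1\<^sub>m N"
    using assms(1) by (intro eq_matI)
      (auto simp: U_def U'_def scalar_prod_def atLeast0LessThan orthonormal_def ip_def)
  \<comment> \<open>A left inverse of a square matrix is also a right inverse; read entrywise, the
    product in this order is the resolution of the identity.\<close>
  hence "U * U' = 1\<^sub>m N" by (rule mat_mult_left_right_inverse[OF c(2,1)])
  hence "(U * U') $$ (k,l) = of_bool (k = l)" using assms by simp
  thus ?thesis using assms by (simp add: U_def U'_def scalar_prod_def atLeast0LessThan)
qed

lemma parseval:
  assumes "orthonormal N N E"
  shows "(\<Sum>i<N. cnj (ip N (E i) v) * ip N (E i) w) = ip N v w"
proof -
  have "(\<Sum>i<N. cnj (ip N (E i) v) * ip N (E i) w)
      = (\<Sum>i<N. \<Sum>k<N. \<Sum>l<N. cnj (v k) * w l * (E i k * cnj (E i l)))"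
    unfolding ip_def cnj_sum sum_product by (simp add: mult_ac)
  also have "\<dots> = (\<Sum>k<N. \<Sum>i<N. \<Sum>l<N. cnj (v k) * w l * (E i k * cnj (E i l)))"
    by (rule sum.swap)
  also have "\<dots> = (\<Sum>k<N. \<Sum>l<N. \<Sum>i<N. cnj (v k) * w l * (E i k * cnj (E i l)))"
    by (rule sum.cong[OF refl], rule sum.swap)
  also have "\<dots> = (\<Sum>k<N. \<Sum>l<N. if l = k then cnj (v k) * w l else 0)"
    by (intro sum.cong refl) (simp add: sum_distrib_left[symmetric] orthonormal_complete[OF assms])
  also have "\<dots> = ip N v w" by (simp add: ip_def)
  finally show ?thesis .
qed

lemma parseval_norm:
  assumes "orthonormal N N E"
  shows "(\<Sum>i<N. (cmod (ip N (E i) v))\<^sup>2) = Re (ip N v v)"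
proof -
  have "complex_of_real (\<Sum>i<N. (cmod (ip N (E i) v))\<^sup>2) = ip N v v"
    unfolding parseval[OF assms, of v v, symmetric]
    by (simp add: complex_norm_square mult.commute del: of_real_power)
  thus ?thesis by (metis Re_complex_of_real)
qed

text \<open>Keeping the spectral decomposition as explicit data replaces functional calculus:
  logarithms and resolvents are later applied to the numbers \<open>r i\<close> only.\<close>

definition eigensystem :: "nat \<Rightarrow> complex mat \<Rightarrow> (nat \<Rightarrow> nat \<Rightarrow> complex) \<Rightarrow> (nat \<Rightarrow> real) \<Rightarrow> bool" where
  "eigensystem N A E r \<longleftrightarrow> A \<in> carrier_mat N N \<and> orthonormal N N E \<and>
     (\<forall>k<N. \<forall>l<N. A $$ (k,l) = (\<Sum>i<N. of_real (r i) * E i k * cnj (E i l)))"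

lemma hermitian_eigensystem:
  assumes A: "hermitian N A"
  shows "\<exists>E r. eigensystem N A E r"
proof -
  obtain E :: "nat \<Rightarrow> nat \<Rightarrow> complex" and r :: "nat \<Rightarrow> real" where E: "orthonormal N N E" "\<And>i l. i < N \<Longrightarrow> l < N \<Longrightarrow> mv N A (E i) l = r i * E i l"
    using hermitian_eigenvectors[OF A order_refl] by auto
  have "A $$ (k,l) = (\<Sum>i<N. of_real (r i) * E i k * cnj (E i l))" if kl: "k < N" "l < N" for k l
  proof -
    have "A $$ (k,l) = (\<Sum>m<N. if m = l then A $$ (k,m) else 0)" using kl by simp
    \<comment> \<open>The Kronecker delta is expanded by completeness, so that \<open>A\<close>
      meets its eigenvectors.\<close>
    also have "\<dots> = (\<Sum>m<N. A $$ (k,m) * (\<Sum>i<N. E i m * cnj (E i l)))"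
      using kl by (intro sum.cong refl) (simp add: orthonormal_complete[OF E(1)])
    also have "\<dots> = (\<Sum>m<N. \<Sum>i<N. A $$ (k,m) * E i m * cnj (E i l))"
      by (simp add: sum_distrib_left mult_ac)
    also have "\<dots> = (\<Sum>i<N. \<Sum>m<N. A $$ (k,m) * E i m * cnj (E i l))" by (rule sum.swap)
    also have "\<dots> = (\<Sum>i<N. mv N A (E i) k * cnj (E i l))"
      by (simp add: mv_def sum_distrib_right)
    finally show ?thesis using E(2) kl by simp
  qed
  thus ?thesis using A E(1) unfolding eigensystem_def hermitian_def by blast
qed

lemma eigensystem_mv:
  assumes "eigensystem N A E r" "k < N"
  shows "mv N A v k = (\<Sum>i<N. of_real (r i) * ip N (E i) v * E i k)"
proof -
  have "mv N A v k = (\<Sum>l<N. \<Sum>i<N. of_real (r i) * E i k * cnj (E i l) * v l)"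
    using assms by (simp add: mv_def eigensystem_def sum_distrib_right)
  also have "\<dots> = (\<Sum>i<N. \<Sum>l<N. of_real (r i) * E i k * cnj (E i l) * v l)" by (rule sum.swap)
  also have "\<dots> = (\<Sum>i<N. of_real (r i) * ip N (E i) v * E i k)"
    by (simp add: ip_def sum_distrib_left sum_distrib_right mult_ac)
  finally show ?thesis .
qed

lemma eigensystem_quadratic:
  assumes "eigensystem N A E r"
  shows "ip N v (mv N A v) = of_real (\<Sum>i<N. r i * (cmod (ip N (E i) v))\<^sup>2)"
proof -
  have "ip N v (mv N A v) = ip N v (\<lambda>k. \<Sum>i<N. of_real (r i) * ip N (E i) v * E i k)"
    by (intro ip_cong refl eigensystem_mv[OF assms])
  also have "\<dots> = (\<Sum>i<N. of_real (r i) * ip N (E i) v * ip N v (E i))"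
    by (simp add: ip_sum_right ip_scale_right)
  also have "\<dots> = of_real (\<Sum>i<N. r i * (cmod (ip N (E i) v))\<^sup>2)"
    by (simp add: complex_norm_square cnj_ip mult_ac del: of_real_power)
  finally show ?thesis .
qed

lemma eigensystem_eigenvalue:
  assumes "eigensystem N A E r" "i < N"
  shows "r i = Re (ip N (E i) (mv N A (E i)))"
proof -
  have "(\<Sum>j<N. r j * (cmod (ip N (E j) (E i)))\<^sup>2) = (\<Sum>j<N. if j = i then r j else 0)"
    using assms by (intro sum.cong) (auto simp: eigensystem_def orthonormal_def)
  thus ?thesis using assms by (simp add: eigensystem_quadratic)
qed

lemma eigensystem_mtrace:
  assumes "eigensystem N A E r"
  shows "mtrace A = of_real (\<Sum>i<N. r i)"
proof -
  have "mtrace A = (\<Sum>k<N. \<Sum>i<N. of_real (r i) * E i k * cnj (E i k))"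
    using assms by (auto simp: mtrace_def eigensystem_def)
  also have "\<dots> = (\<Sum>i<N. of_real (r i) * ip N (E i) (E i))"
    by (subst sum.swap) (simp add: ip_def sum_distrib_left mult_ac)
  finally show ?thesis using assms by (simp add: eigensystem_def orthonormal_def)
qed

lemma eigensystem_mtrace_mult:
  assumes "eigensystem N A E r" "B \<in> carrier_mat N N"
  shows "mtrace (A * B) = (\<Sum>i<N. of_real (r i) * ip N (E i) (mv N B (E i)))"
proof -
  have "mtrace (A * B) = mtrace (B * A)"
    using assms by (intro mtrace_mult_comm) (auto simp: eigensystem_def)
  also have "\<dots> = (\<Sum>k<N. \<Sum>l<N. \<Sum>i<N. B $$ (k,l) * (of_real (r i) * E i l * cnj (E i k)))"
    using assms by (auto simp: mtrace_def eigensystem_def scalar_prod_def atLeast0LessThan sum_distrib_left intro!: sum.cong)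
  also have "\<dots> = (\<Sum>k<N. \<Sum>i<N. \<Sum>l<N. B $$ (k,l) * (of_real (r i) * E i l * cnj (E i k)))"
    by (rule sum.cong[OF refl], rule sum.swap)
  also have "\<dots> = (\<Sum>i<N. \<Sum>k<N. \<Sum>l<N. B $$ (k,l) * (of_real (r i) * E i l * cnj (E i k)))"
    by (rule sum.swap)
  also have "\<dots> = (\<Sum>i<N. of_real (r i) * ip N (E i) (mv N B (E i)))"
    by (simp add: ip_def mv_def sum_distrib_left mult_ac)
  finally show ?thesis .
qed

section \<open>Characteristic polynomial and entropy\<close>

lemma eigensystem_char_poly:
  assumes "eigensystem N A E r"
  shows "char_poly A = (\<Prod>a\<leftarrow>map (\<lambda>i. complex_of_real (r i)) [0..<N]. [:- a, 1:])"
proof -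
  define U where "U = Matrix.mat N N (\<lambda>(k,i). E i k)"
  define U' where "U' = Matrix.mat N N (\<lambda>(i,k). cnj (E i k))"
  define D where "D = Matrix.mat N N (\<lambda>(i,j). if i = j then complex_of_real (r i) else 0)"
  have c: "U \<in> carrier_mat N N" "U' \<in> carrier_mat N N" "D \<in> carrier_mat N N" "A \<in> carrier_mat N N"
    using assms by (auto simp: U_def U'_def D_def eigensystem_def)
  have 1: "U' * U = 1\<^sub>m N"
    using assms by (intro eq_matI)
      (auto simp: U_def U'_def scalar_prod_def atLeast0LessThan orthonormal_def eigensystem_def ip_def)
  have 2: "U * U' = 1\<^sub>m N" by (rule mat_mult_left_right_inverse[OF c(2,1) 1])
  have UD: "U * D = Matrix.mat N N (\<lambda>(k,i). of_real (r i) * E i k)"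
    by (intro eq_matI) (auto simp: U_def D_def scalar_prod_def atLeast0LessThan if_distrib[of "\<lambda>x. _ * x"] cong: if_cong)
  have "A = U * D * U'"
    unfolding UD using assms c by (intro eq_matI)
      (auto simp: U'_def scalar_prod_def atLeast0LessThan eigensystem_def)
  hence "similar_mat_wit A D U U'"
    using c 1 2 unfolding similar_mat_wit_def Let_def by auto
  hence "similar_mat A D" unfolding similar_mat_def by blast
  hence "char_poly A = char_poly D" by (rule char_poly_similar)
  also have "\<dots> = (\<Prod>a\<leftarrow>diag_mat D. [:- a, 1:])"
    by (rule char_poly_upper_triangular[OF c(3)]) (auto simp: D_def)
  also have "diag_mat D = map (\<lambda>i. complex_of_real (r i)) [0..<N]"
    by (auto simp: diag_mat_def D_def)
  finally show ?thesis .
qed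

text \<open>\<open>vN_entropy\<close> sums over distinct roots weighted by their order. The order of
  a root is its number of occurrences in \<open>as\<close>, so the sum can be taken along the list
  of eigenvalues instead.\<close>

lemma sum_roots_order:
  fixes as :: "complex list"
  shows "(\<Sum>z\<in>{z. poly (\<Prod>a\<leftarrow>as. [:- a, 1:]) z = 0}. real (Polynomial.order z (\<Prod>a\<leftarrow>as. [:- a, 1:])) * f z) = (\<Sum>a\<leftarrow>as. f a)"
proof -
  have nz: "(\<Prod>a\<leftarrow>as. [:- a, 1:]) \<noteq> 0" for as :: "complex list"
    by (induction as) (simp_all del: mult_pCons_left)
  have ord: "Polynomial.order z (\<Prod>a\<leftarrow>as. [:- a, 1:]) = count_list as z" for z :: complex and as
  proof (induction as)
    case (Cons a as)
    have "Polynomial.order z [:- a, 1:] = of_bool (a = z)"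
      using order_power_n_n[of z 1] by (auto simp: order_root intro!: order_0I)
    thus ?case using nz[of "a # as"] Cons.IH by (simp add: order_mult del: mult_pCons_left)
  qed simp
  have roots: "{z. poly (\<Prod>a\<leftarrow>as. [:- a, 1:]) z = 0} = set as"
    by (induction as) auto
  show ?thesis
    unfolding ord roots
  proof -
    \<comment> \<open>The induction needs a fixed finite superset \<open>S\<close>, because
      \<open>set as\<close> changes with the list; elements outside the list count zero
      times.\<close>
    have "(\<Sum>z\<in>S. real (count_list as z) * f z) = (\<Sum>a\<leftarrow>as. f a)" if "set as \<subseteq> S" "finite S" for S
      using that
    proof (induction as)
      case (Cons a as)
      have "(\<Sum>z\<in>S. real (count_list (a # as) z) * f z)
          = (\<Sum>z\<in>S. (if z = a then f z else 0) + real (count_list as z) * f z)"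
        by (intro sum.cong) (auto simp: algebra_simps)
      thus ?case using Cons by (simp add: sum.distrib)
    qed simp
    thus "(\<Sum>z\<in>set as. real (count_list as z) * f z) = (\<Sum>a\<leftarrow>as. f a)" by simp
  qed
qed

lemma vN_entropy_eigensystem:
  assumes "eigensystem N A E r"
  shows "vN_entropy A = - (\<Sum>i<N. eta (r i))"
  unfolding vN_entropy_def eigensystem_char_poly[OF assms] sum_roots_order
  by (simp add: interv_sum_list_conv_sum_set_nat atLeast0LessThan o_def)

subsection \<open>Data processing for binary tests\<close>

text \<open>Positivity is asked only where the weight is non-zero. The other terms vanish
  identically, so zero eigenvalues, where \<open>ln\<close> has a default value, do no harm.\<close>

lemma sum_ln_tendsto_at_0:
  fixes w r s :: "'i \<Rightarrow> real"
  assumes "\<And>k. k \<in> K \<Longrightarrow> w k \<noteq> 0 \<Longrightarrow> r k > 0 \<and> s k > 0"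
  shows "((\<lambda>t. \<Sum>k\<in>K. w k * ln (s k + t * r k)) \<longlongrightarrow> (\<Sum>k\<in>K. w k * ln (s k))) (at_right 0)"
proof (rule tendsto_sum)
  fix k assume k: "k \<in> K"
  show "((\<lambda>t. w k * ln (s k + t * r k)) \<longlongrightarrow> w k * ln (s k)) (at_right 0)"
  proof (cases "w k = 0")
    case False
    with assms[OF k] have "s k > 0" by simp
    thus ?thesis by (auto intro!: tendsto_eq_intros)
  qed simp
qed

text \<open>For large \<open>t\<close>, \<open>ln (s + t * r) - ln t = ln (r + s / t)\<close>, so
  each term converges once its share of \<open>ln t\<close> is removed.\<close>

lemma sum_ln_tendsto_at_top:
  fixes w r s :: "'i \<Rightarrow> real"
  assumes "\<And>k. k \<in> K \<Longrightarrow> w k \<noteq> 0 \<Longrightarrow> r k > 0 \<and> s k > 0"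
  shows "((\<lambda>t. (\<Sum>k\<in>K. w k * ln (s k + t * r k)) - (\<Sum>k\<in>K. w k) * ln t) \<longlongrightarrow> (\<Sum>k\<in>K. w k * ln (r k))) at_top"
  unfolding sum_distrib_right sum_subtractf[symmetric]
proof (rule tendsto_sum)
  fix k assume k: "k \<in> K"
  show "((\<lambda>t. w k * ln (s k + t * r k) - w k * ln t) \<longlongrightarrow> w k * ln (r k)) at_top"
  proof (cases "w k = 0")
    case False
    with assms[OF k] have "r k > 0" "s k > 0" by auto
    hence "((\<lambda>t. ln (s k + t * r k) - ln t) \<longlongrightarrow> ln (r k)) at_top"
      by real_asymp
    hence "((\<lambda>t. w k * (ln (s k + t * r k) - ln t)) \<longlongrightarrow> w k * ln (r k)) at_top"
      by (intro tendsto_intros)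
    thus ?thesis by (simp add: algebra_simps)
  qed simp
qed

lemma sum_ln_has_derivative:
  fixes w r s :: "'i \<Rightarrow> real"
  assumes "\<And>k. k \<in> K \<Longrightarrow> w k \<noteq> 0 \<Longrightarrow> r k > 0 \<and> s k > 0" and "t > 0"
  shows "((\<lambda>t. \<Sum>k\<in>K. w k * ln (s k + t * r k)) has_real_derivative (\<Sum>k\<in>K. w k * r k / (s k + t * r k))) (at t)"
proof (rule DERIV_sum)
  fix k assume k: "k \<in> K"
  show "((\<lambda>t. w k * ln (s k + t * r k)) has_real_derivative w k * r k / (s k + t * r k)) (at t)"
  proof (cases "w k = 0")
    case False
    with assms(1)[OF k] \<open>t > 0\<close> have "s k + t * r k > 0" by (simp add: add_pos_pos)
    thus ?thesis by (auto intro!: derivative_eq_intros)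
  qed simp
qed

text \<open>Integration over \<open>t\<close> of the hypothesis, in disguise: the difference of the two logarithmic sums
  is monotone, and its values at \<open>0\<close> and \<open>\<infinity>\<close> give the two relative entropies.\<close>

lemma relative_entropy_mono_of_resolvents:
  fixes w r s :: "'i \<Rightarrow> real" and w' r' s' :: "'j \<Rightarrow> real"
  assumes pos: "\<And>k. k \<in> K \<Longrightarrow> w k \<noteq> 0 \<Longrightarrow> r k > 0 \<and> s k > 0"
    and pos': "\<And>k. k \<in> L \<Longrightarrow> w' k \<noteq> 0 \<Longrightarrow> r' k > 0 \<and> s' k > 0"
    and tot: "(\<Sum>k\<in>K. w k) = (\<Sum>k\<in>L. w' k)"
    and res: "\<And>t. t > 0 \<Longrightarrow> (\<Sum>k\<in>L. w' k * r' k / (s' k + t * r' k)) \<le> (\<Sum>k\<in>K. w k * r k / (s k + t * r k))"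
  shows "(\<Sum>k\<in>L. w' k * (ln (r' k) - ln (s' k))) \<le> (\<Sum>k\<in>K. w k * (ln (r k) - ln (s k)))"
proof -
  define f where "f t = (\<Sum>k\<in>K. w k * ln (s k + t * r k)) - (\<Sum>k\<in>L. w' k * ln (s' k + t * r' k))" for t
  have der: "(f has_real_derivative (\<Sum>k\<in>K. w k * r k / (s k + t * r k)) - (\<Sum>k\<in>L. w' k * r' k / (s' k + t * r' k))) (at t)"
    if "t > 0" for t
    unfolding f_def
    by (intro DERIV_diff sum_ln_has_derivative pos pos' that)
  have mono: "f t \<le> f u" if "0 < t" "t \<le> u" for t u
  proof (rule DERIV_nonneg_imp_nondecreasing[OF that(2)])
    fix x assume "t \<le> x"
    with that have "x > 0" by simp
    with der[OF this] res[OF this] show "\<exists>y. (f has_real_derivative y) (at x) \<and> 0 \<le> y"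
      by (intro exI conjI) auto
  qed
  \<comment> \<open>The limits of \<open>f\<close> at 0 and at infinity are compared through
    \<open>f 1\<close>; the point 1 is only an intermediate one.\<close>
  have "(f \<longlongrightarrow> (\<Sum>k\<in>K. w k * ln (s k)) - (\<Sum>k\<in>L. w' k * ln (s' k))) (at_right 0)"
    unfolding f_def by (intro tendsto_diff sum_ln_tendsto_at_0 pos pos')
  moreover have "eventually (\<lambda>t. f t \<le> f 1) (at_right 0)"
    unfolding eventually_at_right_field by (intro exI[of _ 1]) (auto intro: mono)
  ultimately have 0: "(\<Sum>k\<in>K. w k * ln (s k)) - (\<Sum>k\<in>L. w' k * ln (s' k)) \<le> f 1"
    by (rule tendsto_upperbound) simp
  \<comment> \<open>By \<open>tot\<close> the two multiples of \<open>ln t\<close> cancel, so this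
    is the limit of \<open>f\<close> itself.\<close>
  have "((\<lambda>t. ((\<Sum>k\<in>K. w k * ln (s k + t * r k)) - (\<Sum>k\<in>K. w k) * ln t)
      - ((\<Sum>k\<in>L. w' k * ln (s' k + t * r' k)) - (\<Sum>k\<in>L. w' k) * ln t))
      \<longlongrightarrow> (\<Sum>k\<in>K. w k * ln (r k)) - (\<Sum>k\<in>L. w' k * ln (r' k))) at_top"
    by (intro tendsto_diff sum_ln_tendsto_at_top pos pos')
  hence "(f \<longlongrightarrow> (\<Sum>k\<in>K. w k * ln (r k)) - (\<Sum>k\<in>L. w' k * ln (r' k))) at_top"
    by (simp add: f_def[abs_def] tot)
  moreover have "eventually (\<lambda>t. f 1 \<le> f t) at_top"
    using eventually_ge_at_top[of 1] by (eventually_elim) (auto intro: mono)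
  ultimately have "f 1 \<le> (\<Sum>k\<in>K. w k * ln (r k)) - (\<Sum>k\<in>L. w' k * ln (r' k))"
    by (rule tendsto_lowerbound) simp
  thus ?thesis using 0 by (simp add: algebra_simps sum_subtractf)
qed

section \<open>Effects and the variational bound for resolvent sums\<close>

definition qform :: "nat \<Rightarrow> complex mat \<Rightarrow> (nat \<Rightarrow> complex) \<Rightarrow> real" where
  "qform N A v = Re (ip N v (mv N A v))"

definition effect :: "nat \<Rightarrow> complex mat \<Rightarrow> bool" where
  "effect N b \<longleftrightarrow> psd N b \<and> (\<forall>v. qform N b v \<le> Re (ip N v v))"

lemma qform_nonneg: "psd N A \<Longrightarrow> qform N A v \<ge> 0"
  by (simp add: psd_iff qform_def)

lemma ip_mv_eq_qform: "psd N A \<Longrightarrow> ip N v (mv N A v) = of_real (qform N A v)"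
  unfolding qform_def by (rule psd_real)

lemma eigensystem_ip_mv:
  assumes "eigensystem N A E r" "i < N"
  shows "ip N (E i) (mv N A v) = r i * ip N (E i) v"
proof -
  have "ip N (E i) (mv N A v) = (\<Sum>j<N. of_real (r j) * ip N (E j) v * ip N (E i) (E j))"
    by (simp add: ip_cong[OF refl eigensystem_mv[OF assms(1)]] ip_sum_right ip_scale_right)
  also have "\<dots> = (\<Sum>j<N. if j = i then of_real (r j) * ip N (E j) v else 0)"
    using assms by (intro sum.cong) (auto simp: eigensystem_def orthonormal_def)
  finally show ?thesis using assms by simp
qed

text \<open>The operator \<open>X = c b + c' (1 - b)\<close> applied to \<open>v\<close>, with
  coefficient \<open>c\<close> on the test and \<open>c'\<close> on its complement.\<close>

definition interpolate :: "nat \<Rightarrow> complex mat \<Rightarrow> real \<Rightarrow> real \<Rightarrow> (nat \<Rightarrow> complex) \<Rightarrow> nat \<Rightarrow> complex" where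
  "interpolate N b c c' v k = of_real c' * v k + of_real (c - c') * mv N b v k"

lemma ip_interpolate:
  "ip N v (interpolate N b c c' w) = c' * ip N v w + (c - c') * ip N v (mv N b w)"
  unfolding interpolate_def[abs_def] ip_add_right ip_scale_right by simp

lemma interpolate_hermitian:
  assumes "hermitian N b"
  shows "ip N (interpolate N b c c' v) w = ip N v (interpolate N b c c' w)"
  unfolding ip_interpolate
  unfolding interpolate_def[abs_def] ip_add_left ip_scale_left hermitian_ip[OF assms] by simp

text \<open>Convexity of the square: as the eigenvalues of \<open>b\<close> lie in [0,1], the square
  of \<open>c b + c' (1 - b)\<close> is at most
  \<open>c\<^sup>2 b + c'\<^sup>2 (1 - b)\<close>.\<close>

lemma interpolate_norm:
  assumes b: "effect N b"
  shows "Re (ip N (interpolate N b c c' v) (interpolate N b c c' v))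
    \<le> c\<^sup>2 * qform N b v + c'\<^sup>2 * (Re (ip N v v) - qform N b v)"
proof -
  have p: "psd N b" using b by (simp add: effect_def)
  obtain E r where E: "eigensystem N b E r"
    using hermitian_eigensystem[OF psd_hermitian[OF p]] by blast
  have on: "orthonormal N N E" using E by (simp add: eigensystem_def)
  have r: "0 \<le> r i" "r i \<le> 1" if "i < N" for i
  proof -
    have "r i = qform N b (E i)" unfolding qform_def by (rule eigensystem_eigenvalue[OF E that])
    moreover have "Re (ip N (E i) (E i)) = 1" using on that by (simp add: orthonormal_def)
    ultimately show "0 \<le> r i" "r i \<le> 1" using qform_nonneg[OF p] b by (auto simp: effect_def) (metis)
  qed
  have "Re (ip N (interpolate N b c c' v) (interpolate N b c c' v))
      = (\<Sum>i<N. (cmod (of_real (c' + (c - c') * r i) * ip N (E i) v))\<^sup>2)"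
    unfolding parseval_norm[OF on, symmetric]
    by (intro sum.cong refl) (simp add: ip_interpolate eigensystem_ip_mv[OF E] algebra_simps)
  also have "\<dots> = (\<Sum>i<N. (c' + (c - c') * r i)\<^sup>2 * (cmod (ip N (E i) v))\<^sup>2)"
    by (simp only: norm_mult power_mult_distrib norm_of_real power2_abs)
  also have "\<dots> \<le> (\<Sum>i<N. (c\<^sup>2 * r i + c'\<^sup>2 * (1 - r i)) * (cmod (ip N (E i) v))\<^sup>2)"
  proof (intro sum_mono mult_right_mono)
    fix i assume "i \<in> {..<N}"
    \<comment> \<open>This is the variance of a variable that equals \<open>c\<close> with
      probability \<open>r i\<close> and \<open>c'\<close> otherwise.\<close>
    hence "0 \<le> (c - c')\<^sup>2 * (r i * (1 - r i))" using r[of i] by simp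
    also have "\<dots> = (c\<^sup>2 * r i + c'\<^sup>2 * (1 - r i)) - (c' + (c - c') * r i)\<^sup>2"
      by (simp add: power2_eq_square algebra_simps)
    finally show "(c' + (c - c') * r i)\<^sup>2 \<le> c\<^sup>2 * r i + c'\<^sup>2 * (1 - r i)" by simp
  qed simp
  also have "\<dots> = c\<^sup>2 * qform N b v + c'\<^sup>2 * (Re (ip N v v) - qform N b v)"
    unfolding qform_def eigensystem_quadratic[OF E] parseval_norm[OF on, symmetric]
    by (simp add: sum_distrib_left sum_subtractf[symmetric] sum.distrib[symmetric] algebra_simps)
  finally show ?thesis .
qed

text \<open>Completing the square: for \<open>y > 0\<close>, the gap times \<open>y\<close> is the
  squared modulus of \<open>r * a - y * cnj z\<close>. For \<open>y = 0\<close> the quotient is 0 by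
  convention, and so is the left-hand side because \<open>r = 0\<close>.\<close>

lemma quadratic_lower_bound:
  fixes a z :: complex and y r :: real
  assumes "y \<ge> 0" "y = 0 \<Longrightarrow> r = 0"
  shows "2 * r * Re (a * z) - y * (cmod z)\<^sup>2 \<le> (cmod a)\<^sup>2 * r\<^sup>2 / y"
proof (cases "y = 0")
  case False
  hence y: "y > 0" using assms by simp
  have "0 \<le> (cmod (r * a - y * cnj z))\<^sup>2" by simp
  also have "\<dots> = r\<^sup>2 * (cmod a)\<^sup>2 - 2 * r * y * Re (a * z) + y\<^sup>2 * (cmod z)\<^sup>2"
    unfolding cmod_power2 by (simp add: power2_eq_square algebra_simps)
  finally show ?thesis using y by (simp add: field_simps power2_eq_square)
qed (use assms in simp)

text \<open>The left-hand side is the supremum over \<open>X\<close> of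
  \<open>2 Re tr(X \<rho>) - tr(X\<^sup>* \<sigma> X) - t tr(X \<rho> X\<^sup>*)\<close>; it is bounded below by the choice \<open>X = c b + c' (1 - b)\<close>.\<close>

lemma resolvent_binary_bound:
  assumes E: "eigensystem N \<rho> E r" and F: "eigensystem N \<sigma> F s" and b: "effect N b"
    and r: "\<And>i. i < N \<Longrightarrow> r i \<ge> 0" "(\<Sum>i<N. r i) = 1"
    and s: "\<And>i. i < N \<Longrightarrow> s i \<ge> 0" "(\<Sum>i<N. s i) = 1"
    and "t > 0"
  defines "p \<equiv> \<Sum>i<N. r i * qform N b (E i)" and "q \<equiv> \<Sum>j<N. s j * qform N b (F j)"
  shows "2 * (c * p + c' * (1 - p)) - c\<^sup>2 * (q + t * p) - c'\<^sup>2 * ((1 - q) + t * (1 - p))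
    \<le> (\<Sum>i<N. \<Sum>j<N. (cmod (ip N (E i) (F j)))\<^sup>2 * (r i)\<^sup>2 / (s j + t * r i))"
proof -
  have p: "psd N b" using b by (simp add: effect_def)
  note h = psd_hermitian[OF p]
  have onE: "orthonormal N N E" and onF: "orthonormal N N F"
    using E F by (simp_all add: eigensystem_def)
  define X where "X = interpolate N b c c'"
  \<comment> \<open>In the matrix elements of \<open>X\<close> between the two eigenbases every
    trace becomes a double sum, which can be estimated term by term.\<close>
  define z where "z i j = ip N (F j) (X (E i))" for i j
  have E1: "ip N (E i) (E i) = 1" if "i < N" for i using onE that by (simp add: orthonormal_def)
  have F1: "ip N (F i) (F i) = 1" if "i < N" for i using onF that by (simp add: orthonormal_def)
  have az: "(\<Sum>j<N. Re (ip N (E i) (F j) * z i j)) = c * qform N b (E i) + c' * (1 - qform N b (E i))"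
    if "i < N" for i
  proof -
    have "(\<Sum>j<N. ip N (E i) (F j) * z i j) = ip N (E i) (X (E i))"
      unfolding z_def by (subst parseval[OF onF, symmetric]) (simp only: cnj_ip)
    hence "(\<Sum>j<N. Re (ip N (E i) (F j) * z i j)) = Re (ip N (E i) (X (E i)))"
      by (metis Re_sum)
    thus ?thesis
      using that by (simp add: X_def ip_interpolate E1 ip_mv_eq_qform[OF p] algebra_simps)
  qed
  have zj: "(\<Sum>j<N. (cmod (z i j))\<^sup>2) \<le> c\<^sup>2 * qform N b (E i) + c'\<^sup>2 * (1 - qform N b (E i))" if "i < N" for i
    unfolding z_def parseval_norm[OF onF] X_def
    using interpolate_norm[OF b, of c c' "E i"] E1[OF that] by simp
  \<comment> \<open>\<open>X\<close> is self-adjoint, so summing over the other index also gives a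
    squared norm, now of \<open>X (F j)\<close>.\<close>
  have zi: "(\<Sum>i<N. (cmod (z i j))\<^sup>2) \<le> c\<^sup>2 * qform N b (F j) + c'\<^sup>2 * (1 - qform N b (F j))" if "j < N" for j
  proof -
    have "ip N (E i) (X (F j)) = cnj (z i j)" for i
      unfolding z_def X_def cnj_ip interpolate_hermitian[OF h] ..
    hence "cmod (z i j) = cmod (ip N (E i) (X (F j)))" for i by simp
    hence "(\<Sum>i<N. (cmod (z i j))\<^sup>2) = Re (ip N (X (F j)) (X (F j)))"
      by (simp add: parseval_norm[OF onE])
    thus ?thesis unfolding X_def
      using interpolate_norm[OF b, of c c' "F j"] F1[OF that] by simp
  qed
  \<comment> \<open>Averaging with weights of total one turns the bounds for single eigenvectors
    into bounds in \<open>p\<close> and \<open>q\<close>.\<close>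
  have lin: "(\<Sum>i<N. f i * (x * g i + y * (1 - g i))) = x * (\<Sum>i<N. f i * g i) + y * (1 - (\<Sum>i<N. f i * g i))"
    if "(\<Sum>i<N. f i) = 1" for f g :: "nat \<Rightarrow> real" and x y
  proof -
    have "(\<Sum>i<N. f i * (x * g i + y * (1 - g i))) = x * (\<Sum>i<N. f i * g i) + y * ((\<Sum>i<N. f i) - (\<Sum>i<N. f i * g i))"
      by (simp add: algebra_simps sum.distrib sum_subtractf sum_distrib_left)
    thus ?thesis by (simp add: that)
  qed
  \<comment> \<open>The double sums bounded or evaluated in \<open>1\<close>, \<open>2\<close> and
    \<open>3\<close> are the traces of \<open>\<sigma> X\<^sup>2\<close>,
    \<open>\<rho> X\<^sup>2\<close> and \<open>\<rho> X\<close>.\<close>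
  have "(\<Sum>i<N. \<Sum>j<N. s j * (cmod (z i j))\<^sup>2) = (\<Sum>j<N. s j * (\<Sum>i<N. (cmod (z i j))\<^sup>2))"
    by (subst sum.swap) (simp add: sum_distrib_left)
  also have "\<dots> \<le> (\<Sum>j<N. s j * (c\<^sup>2 * qform N b (F j) + c'\<^sup>2 * (1 - qform N b (F j))))"
    using zi s(1) by (intro sum_mono mult_left_mono) auto
  finally have 1: "(\<Sum>i<N. \<Sum>j<N. s j * (cmod (z i j))\<^sup>2) \<le> c\<^sup>2 * q + c'\<^sup>2 * (1 - q)"
    unfolding lin[OF s(2)] q_def .
  have "(\<Sum>i<N. \<Sum>j<N. r i * (cmod (z i j))\<^sup>2) = (\<Sum>i<N. r i * (\<Sum>j<N. (cmod (z i j))\<^sup>2))"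
    by (simp add: sum_distrib_left)
  also have "\<dots> \<le> (\<Sum>i<N. r i * (c\<^sup>2 * qform N b (E i) + c'\<^sup>2 * (1 - qform N b (E i))))"
    using zj r(1) by (intro sum_mono mult_left_mono) auto
  finally have 2: "(\<Sum>i<N. \<Sum>j<N. r i * (cmod (z i j))\<^sup>2) \<le> c\<^sup>2 * p + c'\<^sup>2 * (1 - p)"
    unfolding lin[OF r(2)] p_def .
  have "(\<Sum>i<N. \<Sum>j<N. r i * Re (ip N (E i) (F j) * z i j)) = (\<Sum>i<N. r i * (\<Sum>j<N. Re (ip N (E i) (F j) * z i j)))"
    by (simp only: sum_distrib_left)
  also have "\<dots> = (\<Sum>i<N. r i * (c * qform N b (E i) + c' * (1 - qform N b (E i))))"
    by (intro sum.cong refl) (simp only: az lessThan_iff)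
  finally have 3: "(\<Sum>i<N. \<Sum>j<N. r i * Re (ip N (E i) (F j) * z i j)) = c * p + c' * (1 - p)"
    unfolding lin[OF r(2)] p_def .
  have "t * (\<Sum>i<N. \<Sum>j<N. r i * (cmod (z i j))\<^sup>2) \<le> t * (c\<^sup>2 * p + c'\<^sup>2 * (1 - p))"
    using 2 \<open>t > 0\<close> by (intro mult_left_mono) auto
  with 1 have "2 * (c * p + c' * (1 - p)) - c\<^sup>2 * (q + t * p) - c'\<^sup>2 * ((1 - q) + t * (1 - p))
    \<le> 2 * (\<Sum>i<N. \<Sum>j<N. r i * Re (ip N (E i) (F j) * z i j))
      - (\<Sum>i<N. \<Sum>j<N. s j * (cmod (z i j))\<^sup>2) - t * (\<Sum>i<N. \<Sum>j<N. r i * (cmod (z i j))\<^sup>2)"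
    unfolding 3 by (simp add: algebra_simps)
  also have "\<dots> = (\<Sum>i<N. \<Sum>j<N. 2 * r i * Re (ip N (E i) (F j) * z i j) - (s j + t * r i) * (cmod (z i j))\<^sup>2)"
    by (simp only: sum_distrib_left sum_subtractf[symmetric]) (simp only: algebra_simps)
  \<comment> \<open>The square is completed for each pair separately, with
    \<open>y = s j + t * r i\<close>.\<close>
  also have "\<dots> \<le> (\<Sum>i<N. \<Sum>j<N. (cmod (ip N (E i) (F j)))\<^sup>2 * (r i)\<^sup>2 / (s j + t * r i))"
  proof (intro sum_mono quadratic_lower_bound)
    fix i j assume ij: "i \<in> {..<N}" "j \<in> {..<N}"
    have tr: "t * r i \<ge> 0" using r(1) ij \<open>t > 0\<close> by simp
    show "0 \<le> s j + t * r i" using tr s(1)[of j] ij by simp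
    assume "s j + t * r i = 0"
    moreover have "s j \<ge> 0" using s(1) ij by simp
    ultimately have "t * r i = 0" using tr by linarith
    thus "r i = 0" using \<open>t > 0\<close> by simp
  qed
  finally show ?thesis .
qed

subsection \<open>Entropy and success probability\<close>

lemma qform_sum:
  "qform N (Matrix.mat N N (\<lambda>(k,l). \<Sum>m\<in>I. complex_of_real (c m) * A m $$ (k,l))) v = (\<Sum>m\<in>I. c m * qform N (A m) v)"
  and ip_mv_sum:
  "ip N v (mv N (Matrix.mat N N (\<lambda>(k,l). \<Sum>m\<in>I. complex_of_real (c m) * A m $$ (k,l))) v)
    = (\<Sum>m\<in>I. complex_of_real (c m) * ip N v (mv N (A m) v))"
proof -
  let ?A = "Matrix.mat N N (\<lambda>(k,l). \<Sum>m\<in>I. complex_of_real (c m) * A m $$ (k,l))"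
  have "mv N ?A v k = (\<Sum>m\<in>I. complex_of_real (c m) * mv N (A m) v k)" if "k < N" for k
  proof -
    have "mv N ?A v k = (\<Sum>l<N. \<Sum>m\<in>I. complex_of_real (c m) * (A m $$ (k,l) * v l))"
      using that by (simp add: mv_def sum_distrib_right mult.assoc)
    also have "\<dots> = (\<Sum>m\<in>I. \<Sum>l<N. complex_of_real (c m) * (A m $$ (k,l) * v l))" by (rule sum.swap)
    finally show ?thesis by (simp add: mv_def sum_distrib_left)
  qed
  hence "ip N v (mv N ?A v) = ip N v (\<lambda>k. \<Sum>m\<in>I. complex_of_real (c m) * mv N (A m) v k)"
    by (intro ip_cong refl)
  thus *: "ip N v (mv N ?A v) = (\<Sum>m\<in>I. complex_of_real (c m) * ip N v (mv N (A m) v))"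
    by (simp add: ip_sum_right ip_scale_right)
  show "qform N ?A v = (\<Sum>m\<in>I. c m * qform N (A m) v)"
    unfolding qform_def * by simp
qed

definition density :: "nat \<Rightarrow> complex mat \<Rightarrow> bool" where
  "density N A \<longleftrightarrow> psd N A \<and> mtrace A = 1"

lemma density_mixture:
  assumes "\<And>m. m \<in> I \<Longrightarrow> density N (A m) \<and> c m \<ge> 0" "(\<Sum>m\<in>I. c m) = 1"
  shows "density N (Matrix.mat N N (\<lambda>(k,l). \<Sum>m\<in>I. complex_of_real (c m) * A m $$ (k,l)))"
  unfolding density_def psd_iff ip_mv_sum
proof (intro conjI allI)
  let ?A = "Matrix.mat N N (\<lambda>(k,l). \<Sum>m\<in>I. complex_of_real (c m) * A m $$ (k,l))"
  show "?A \<in> carrier_mat N N" by simp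
  fix v
  have "(\<Sum>m\<in>I. complex_of_real (c m) * ip N v (mv N (A m) v)) = of_real (\<Sum>m\<in>I. c m * qform N (A m) v)"
    using assms(1) by (auto simp: density_def ip_mv_eq_qform intro!: sum.cong)
  moreover have "(\<Sum>m\<in>I. c m * qform N (A m) v) \<ge> 0"
    using assms(1) by (intro sum_nonneg mult_nonneg_nonneg qform_nonneg) (auto simp: density_def)
  ultimately show "Im (\<Sum>m\<in>I. complex_of_real (c m) * ip N v (mv N (A m) v)) = 0"
    "0 \<le> Re (\<Sum>m\<in>I. complex_of_real (c m) * ip N v (mv N (A m) v))" by auto
next
  have "(\<Sum>k<N. A m $$ (k,k)) = 1" if "m \<in> I" for m
    using assms(1)[OF that] psd_carrier[of N "A m"] by (auto simp: density_def mtrace_def)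
  hence "(\<Sum>m\<in>I. complex_of_real (c m) * (\<Sum>k<N. A m $$ (k,k))) = complex_of_real (\<Sum>m\<in>I. c m)"
    by simp
  thus "mtrace (Matrix.mat N N (\<lambda>(k,l). \<Sum>m\<in>I. complex_of_real (c m) * A m $$ (k,l))) = 1"
    unfolding mtrace_def assms(2) by (simp add: sum_distrib_left sum.swap[of _ _ I])
qed

lemma density_eigensystem:
  assumes "density N A"
  shows "\<exists>E r. eigensystem N A E r \<and> (\<forall>i<N. 0 \<le> r i) \<and> (\<Sum>i<N. r i) = 1"
proof -
  have p: "psd N A" using assms by (simp add: density_def)
  obtain E r where E: "eigensystem N A E r"
    using hermitian_eigensystem[OF psd_hermitian[OF p]] by blast
  have "r i \<ge> 0" if "i < N" for i
    using eigensystem_eigenvalue[OF E that] qform_nonneg[OF p] by (simp add: qform_def)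
  moreover have "(\<Sum>i<N. r i) = 1"
    using eigensystem_mtrace[OF E] assms by (metis Re_complex_of_real density_def one_complex.simps(1))
  ultimately show ?thesis using E by blast
qed

section \<open>Entropy estimates\<close>

lemma eta_eq_ln: "0 \<le> t \<Longrightarrow> eta t = t * ln t / ln 2"
  by (simp add: eta_def log_def)

lemma vN_entropy_ln:
  assumes "eigensystem N A E r" "\<forall>i<N. 0 \<le> r i"
  shows "vN_entropy A * ln 2 = - (\<Sum>i<N. r i * ln (r i))"
  using assms by (simp add: vN_entropy_eigensystem eta_eq_ln sum_divide_distrib[symmetric])

lemma vN_entropy_nonneg:
  assumes "density N A"
  shows "vN_entropy A \<ge> 0"
proof -
  obtain E r where E: "eigensystem N A E r" "\<forall>i<N. 0 \<le> r i" "(\<Sum>i<N. r i) = 1"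
    using density_eigensystem[OF assms] by blast
  have "r i * ln (r i) \<le> 0" if "i < N" for i
  proof -
    have "r i \<le> (\<Sum>i<N. r i)" using E(2) that by (intro member_le_sum) auto
    thus ?thesis using E(2,3) that by (cases "r i = 0") (auto simp: mult_le_0_iff)
  qed
  hence "(\<Sum>i<N. r i * ln (r i)) \<le> 0" by (intro sum_nonpos) auto
  with vN_entropy_ln[OF E(1,2)] have "0 \<le> vN_entropy A * ln 2" by simp
  thus ?thesis by (simp add: zero_le_mult_iff)
qed

text \<open>Gibbs' inequality against the uniform distribution, from
  \<open>ln x \<le> x - 1\<close>. It is what keeps the suprema in the capacities finite.\<close>

lemma vN_entropy_le_log_dim:
  assumes "density N A"
  shows "vN_entropy A \<le> log 2 N"
proof -
  obtain E r where E: "eigensystem N A E r" "\<forall>i<N. 0 \<le> r i" "(\<Sum>i<N. r i) = 1"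
    using density_eigensystem[OF assms] by blast
  have "N > 0" using E(3) by (cases N) auto
  have "- (r i * ln (r i)) - r i * ln N \<le> 1 / N - r i" if "i < N" for i
  proof (cases "r i = 0")
    case False
    hence "r i > 0" using E(2) that by (simp add: order.not_eq_order_implies_strict)
    hence "- ln (r i) - ln N = ln (1 / (N * r i))" using \<open>N > 0\<close> by (simp add: ln_mult ln_div)
    also have "\<dots> \<le> 1 / (N * r i) - 1" using \<open>N > 0\<close> \<open>r i > 0\<close> by (intro ln_le_minus_one) simp
    finally have "r i * (- ln (r i) - ln N) \<le> r i * (1 / (N * r i) - 1)"
      using \<open>r i > 0\<close> by (intro mult_left_mono) auto
    thus ?thesis using \<open>r i > 0\<close> by (simp add: algebra_simps)
  qed simp
  hence "(\<Sum>i<N. - (r i * ln (r i)) - r i * ln N) \<le> (\<Sum>i<N. 1 / N - r i)"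
    by (intro sum_mono) auto
  also have "\<dots> = 0" using E(3) \<open>N > 0\<close> by (simp add: sum_subtractf)
  finally have "vN_entropy A * ln 2 \<le> ln N"
    using E(3) by (simp add: vN_entropy_ln[OF E(1,2)] sum_subtractf sum_negf sum_distrib_right[symmetric])
  thus ?thesis by (simp add: log_def field_simps)
qed

text \<open>Gibbs' inequality against a fair coin. This one bit of binary entropy is the source of
  the \<open>1 / n\<close> in the theorem.\<close>

lemma binary_entropy_bound:
  fixes P :: real
  assumes "0 \<le> P" "P \<le> 1"
  shows "P * ln P + (1 - P) * ln (1 - P) \<ge> - ln 2"
proof -
  have *: "x * ln x + x * ln 2 \<ge> x - 1/2" if "0 \<le> x" for x :: real
  proof (cases "x = 0")
    case False
    hence "x > 0" using that by simp
    have "ln (1 / (2 * x)) \<le> 1 / (2 * x) - 1" using \<open>x > 0\<close> by (intro ln_le_minus_one) simp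
    hence "x * - ln (2 * x) \<le> x * (1 / (2 * x) - 1)"
      using \<open>x > 0\<close> by (intro mult_left_mono) (auto simp: ln_div)
    thus ?thesis using \<open>x > 0\<close> by (simp add: ln_mult algebra_simps)
  qed simp
  show ?thesis using *[of P] *[of "1 - P"] assms by (simp add: algebra_simps)
qed

text \<open>The block-diagonal states are never formed: triples \<open>(m,i,j)\<close> label the
  eigenvectors \<open>E m i\<close> of \<open>D m\<close> and \<open>F j\<close> of
  \<open>\<sigma>\<close>, and the common factor \<open>1 / M\<close> cancels in the difference of
  logarithms.\<close>

lemma success_probability_bound:
  fixes D b :: "nat \<Rightarrow> complex mat"
  assumes "M > 0" and D: "\<And>m. m < M \<Longrightarrow> density N (D m)"
    and b: "\<And>m. m < M \<Longrightarrow> psd N (b m)"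
    and b1: "psd N (1\<^sub>m N - Matrix.mat N N (\<lambda>(k,l). \<Sum>m<M. b m $$ (k,l)))"
    and \<sigma>: "\<sigma> = Matrix.mat N N (\<lambda>(k,l). \<Sum>m<M. complex_of_real (1 / M) * D m $$ (k,l))"
    and P: "P = (1 / M) * (\<Sum>m<M. Re (mtrace (D m * b m)))"
  shows "0 \<le> P" and "P * log 2 M - 1 \<le> vN_entropy \<sigma> - (1 / M) * (\<Sum>m<M. vN_entropy (D m))"
proof -
  have "density N \<sigma>" unfolding \<sigma> using D \<open>M > 0\<close> by (intro density_mixture) auto
  then obtain F s where F: "eigensystem N \<sigma> F s" "\<forall>i<N. 0 \<le> s i" "(\<Sum>i<N. s i) = 1"
    using density_eigensystem by blast
  have "\<forall>m. \<exists>E r. m < M \<longrightarrow> eigensystem N (D m) E r \<and> (\<forall>i<N. 0 \<le> r i) \<and> (\<Sum>i<N. r i) = 1"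
    using density_eigensystem[OF D] by blast
  then obtain E r where E: "\<And>m. m < M \<Longrightarrow> eigensystem N (D m) (E m) (r m)"
    and r: "\<And>m i. m < M \<Longrightarrow> i < N \<Longrightarrow> 0 \<le> r m i" "\<And>m. m < M \<Longrightarrow> (\<Sum>i<N. r m i) = 1"
    by metis
  have E1: "ip N (E m i) (E m i) = 1" if "m < M" "i < N" for m i
    using E[OF that(1)] that(2) by (simp add: eigensystem_def orthonormal_def)
  have F1: "ip N (F i) (F i) = 1" if "i < N" for i
    using F(1) that by (simp add: eigensystem_def orthonormal_def)
  have sum_b: "(\<Sum>m<M. qform N (b m) v) \<le> Re (ip N v v)" for v
  proof -
    let ?B = "Matrix.mat N N (\<lambda>(k,l). \<Sum>m<M. b m $$ (k,l))"
    have "mv N (1\<^sub>m N - ?B) v k = v k - mv N ?B v k" if "k < N" for k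
    proof -
      have "mv N (1\<^sub>m N - ?B) v k = (\<Sum>l<N. (if l = k then v l else 0) - ?B $$ (k,l) * v l)"
        using that unfolding mv_def by (intro sum.cong) (auto simp: algebra_simps)
      also have "\<dots> = v k - mv N ?B v k" using that by (simp add: mv_def sum_subtractf)
      finally show ?thesis .
    qed
    hence "ip N v (mv N (1\<^sub>m N - ?B) v) = ip N v (\<lambda>k. v k + (-1) * mv N ?B v k)"
      by (intro ip_cong) auto
    also have "\<dots> = ip N v v - ip N v (mv N ?B v)" unfolding ip_add_right ip_scale_right by simp
    finally have "qform N (1\<^sub>m N - ?B) v = Re (ip N v v) - qform N ?B v" by (simp add: qform_def)
    moreover have "qform N ?B v = (\<Sum>m<M. qform N (b m) v)"
      using qform_sum[where N = N and I = "{..<M}" and c = "\<lambda>_. 1" and A = b and v = v] by simp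
    ultimately show ?thesis using qform_nonneg[OF b1, of v] by simp
  qed
  have eff: "effect N (b m)" if m: "m < M" for m
    unfolding effect_def
  proof (intro conjI allI)
    fix v
    have "qform N (b m) v \<le> (\<Sum>m<M. qform N (b m) v)"
      using m by (intro member_le_sum) (auto intro: qform_nonneg b)
    thus "qform N (b m) v \<le> Re (ip N v v)" using sum_b[of v] by simp
  qed (use b m in blast)

  define p where "p m = (\<Sum>i<N. r m i * qform N (b m) (E m i))" for m
  define q where "q m = (\<Sum>j<N. s j * qform N (b m) (F j))" for m
  have p: "p m = Re (mtrace (D m * b m))" if "m < M" for m
    unfolding p_def eigensystem_mtrace_mult[OF E[OF that] psd_carrier[OF b[OF that]]]
    by (simp add: qform_def)
  have Pp: "P = (1 / M) * (\<Sum>m<M. p m)" by (simp add: P p)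
  have p01: "0 \<le> p m" "p m \<le> 1" if "m < M" for m
  proof -
    show "0 \<le> p m" unfolding p_def using r that b by (intro sum_nonneg mult_nonneg_nonneg qform_nonneg) auto
    have "p m \<le> (\<Sum>i<N. r m i * 1)" unfolding p_def
    proof (intro sum_mono mult_left_mono)
      fix i assume "i \<in> {..<N}"
      thus "qform N (b m) (E m i) \<le> 1" "0 \<le> r m i"
        using eff[OF that] E1[of m i] that r by (auto simp: effect_def) (metis one_complex.simps(1))
    qed
    thus "p m \<le> 1" using r that by simp
  qed
  have P0: "0 \<le> P" unfolding Pp using p01 by (intro mult_nonneg_nonneg sum_nonneg) auto
  thus "0 \<le> P" .
  have "(\<Sum>m<M. p m) \<le> (\<Sum>m<M. 1)" using p01 by (intro sum_mono) auto
  hence P1: "P \<le> 1" unfolding Pp using \<open>M > 0\<close> by (simp add: field_simps)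
  \<comment> \<open>\<open>Q\<close> is the success probability when the output is
    \<open>\<sigma>\<close> whatever the codeword. The \<open>b m\<close> add up to at most the
    identity, which leaves at most \<open>1 / M\<close>.\<close>
  define Q where "Q = (1 / M) * (\<Sum>m<M. q m)"
  have "(\<Sum>m<M. q m) = (\<Sum>j<N. s j * (\<Sum>m<M. qform N (b m) (F j)))"
    unfolding q_def by (subst sum.swap) (simp add: sum_distrib_left)
  also have "\<dots> \<le> (\<Sum>j<N. s j * 1)"
    using F(2) by (intro sum_mono mult_left_mono order.trans[OF sum_b]) (auto simp: F1)
  finally have QM: "Q \<le> 1 / M" unfolding Q_def using F(3) \<open>M > 0\<close> by (simp add: field_simps)
  have Q0: "0 \<le> Q" unfolding Q_def q_def
    using F(2) b by (intro mult_nonneg_nonneg sum_nonneg qform_nonneg) auto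

  define K where "K = {..<M} \<times> {..<N} \<times> {..<N}"
  \<comment> \<open>A joint (Nussbaum-Szkola) distribution of the triples. Its marginals, computed
    in \<open>sj\<close> and \<open>ri\<close>, turn the two halves of the relative entropy into the
    entropies of \<open>\<sigma>\<close> and of the \<open>D m\<close>.\<close>
  define w where "w m i j = (1 / M) * (r m i * (cmod (ip N (E m i) (F j)))\<^sup>2)" for m i j
  have w0: "0 \<le> w m i j" if "m < M" "i < N" for m i j using r that by (simp add: w_def)
  have sumK: "(\<Sum>(m,i,j)\<in>K. f m i j) = (\<Sum>m<M. \<Sum>i<N. \<Sum>j<N. f m i j)" for f :: "nat \<Rightarrow> nat \<Rightarrow> nat \<Rightarrow> real"
    unfolding K_def by (simp add: sum.cartesian_product)
  have sj: "(\<Sum>m<M. \<Sum>i<N. w m i j) = s j" if "j < N" for j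
  proof -
    have "s j = qform N \<sigma> (F j)" unfolding qform_def by (rule eigensystem_eigenvalue[OF F(1) that])
    also have "\<dots> = (\<Sum>m<M. (1 / M) * qform N (D m) (F j))" unfolding \<sigma> by (rule qform_sum)
    also have "\<dots> = (\<Sum>m<M. (1 / M) * (\<Sum>i<N. r m i * (cmod (ip N (E m i) (F j)))\<^sup>2))"
      by (intro sum.cong refl) (simp add: qform_def eigensystem_quadratic[OF E])
    finally show ?thesis by (simp add: w_def sum_distrib_left)
  qed
  have ri: "(\<Sum>j<N. w m i j) = (1 / M) * r m i" if "m < M" "i < N" for m i
  proof -
    have "(\<Sum>j<N. (cmod (ip N (E m i) (F j)))\<^sup>2) = (\<Sum>j<N. (cmod (ip N (F j) (E m i)))\<^sup>2)"
      by (intro sum.cong refl) (metis cnj_ip complex_mod_cnj)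
    also have "\<dots> = 1" using parseval_norm[of N F "E m i"] F(1) E1[OF that] by (simp add: eigensystem_def)
    finally show ?thesis unfolding w_def sum_distrib_left[symmetric] by simp
  qed
  have swap3: "(\<Sum>m<M. \<Sum>i<N. \<Sum>j<N. f m i j) = (\<Sum>j<N. \<Sum>m<M. \<Sum>i<N. f m i j)" for f :: "nat \<Rightarrow> nat \<Rightarrow> nat \<Rightarrow> real"
  proof -
    have "(\<Sum>m<M. \<Sum>i<N. \<Sum>j<N. f m i j) = (\<Sum>m<M. \<Sum>j<N. \<Sum>i<N. f m i j)"
      by (rule sum.cong[OF refl], rule sum.swap)
    also have "\<dots> = (\<Sum>j<N. \<Sum>m<M. \<Sum>i<N. f m i j)" by (rule sum.swap)
    finally show ?thesis .
  qed

  define L where "L = {True, False}"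
  define w' where "w' x = (if x then P else 1 - P)" for x
  \<comment> \<open>Not a distribution: \<open>Q\<close> and \<open>1 - Q\<close> are replaced by
    the upper bounds \<open>1 / M\<close> and 1, whose logarithms are \<open>- ln M\<close> and 0.
    This can only lower the binary relative entropy.\<close>
  define s' where "s' x = (if x then 1 / real M else 1)" for x
  have "(\<Sum>x\<in>L. w' x * (ln (w' x) - ln (s' x)))
     \<le> (\<Sum>k\<in>K. (case k of (m,i,j) \<Rightarrow> w m i j) * (ln (case k of (m,i,j) \<Rightarrow> r m i) - ln (case k of (m,i,j) \<Rightarrow> s j)))"
  proof (rule relative_entropy_mono_of_resolvents)
    fix x assume "x \<in> L" "w' x \<noteq> 0"
    thus "w' x > 0 \<and> s' x > 0" using P0 P1 \<open>M > 0\<close> by (auto simp: w'_def s'_def split: if_splits)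
  next
    fix k assume k: "k \<in> K" "(case k of (m,i,j) \<Rightarrow> w m i j) \<noteq> 0"
    then obtain m i j where mij: "k = (m,i,j)" "m < M" "i < N" "j < N" by (auto simp: K_def)
    have wne: "w m i j \<noteq> 0" using k mij by simp
    hence rpos: "r m i > 0"
      using r(1)[OF mij(2,3)] by (simp add: w_def order.not_eq_order_implies_strict)
    \<comment> \<open>\<open>w m i j\<close> is one term of the marginal \<open>s j\<close>, so
      \<open>s j\<close> is positive wherever the weight is; this reflects that the support of
      \<open>D m\<close> lies in that of \<open>\<sigma>\<close>.\<close>
    have "0 < w m i j" using wne w0[OF mij(2,3)] by (simp add: order.not_eq_order_implies_strict)
    also have "w m i j \<le> (\<Sum>i<N. w m i j)" using w0 mij by (intro member_le_sum) auto
    also have "\<dots> \<le> (\<Sum>m<M. \<Sum>i<N. w m i j)"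
      using w0 mij by (intro member_le_sum[of m _ "\<lambda>m. \<Sum>i<N. w m i j"] sum_nonneg) auto
    also have "\<dots> = s j" by (rule sj[OF mij(4)])
    finally show "0 < (case k of (m,i,j) \<Rightarrow> r m i) \<and> 0 < (case k of (m,i,j) \<Rightarrow> s j)"
      using mij rpos by simp
  next
    show "(\<Sum>k\<in>K. case k of (m,i,j) \<Rightarrow> w m i j) = (\<Sum>x\<in>L. w' x)"
      unfolding sumK swap3 using sj F(3) by (simp add: L_def w'_def)
  next
    fix t :: real assume t: "t > 0"
    \<comment> \<open>\<open>c\<close> maximises
      \<open>2 * c * P - c\<^sup>2 * (1 / M + t * P)\<close>, and \<open>c'\<close> its counterpart
      for the complementary outcome. The maximal values add up to the resolvent sum of the binary
      side.\<close>
    define c where "c = P / (1 / M + t * P)"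
    define c' where "c' = (1 - P) / (1 + t * (1 - P))"
    have d: "1 / M + t * P > 0" "1 + t * (1 - P) > 0"
      using t P0 P1 \<open>M > 0\<close> by (auto intro!: add_pos_nonneg)
    have "(\<Sum>x\<in>L. w' x * w' x / (s' x + t * w' x)) = P * c + (1 - P) * c'"
      by (simp add: L_def w'_def s'_def c_def c'_def)
    also have "\<dots> = 2 * (c * P + c' * (1 - P)) - c\<^sup>2 * (1 / M + t * P) - c'\<^sup>2 * (1 + t * (1 - P))"
    proof -
      have "c * (1 / M + t * P) = P" "c' * (1 + t * (1 - P)) = 1 - P" using d by (auto simp: c_def c'_def)
      thus ?thesis by (simp add: power2_eq_square mult.assoc)
    qed
    also have "\<dots> \<le> 2 * (c * P + c' * (1 - P)) - c\<^sup>2 * (Q + t * P) - c'\<^sup>2 * ((1 - Q) + t * (1 - P))"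
      using QM Q0 by (intro diff_mono order_refl mult_left_mono) auto
    \<comment> \<open>With \<open>c\<close> and \<open>c'\<close> fixed, the expression is affine in
      \<open>P\<close> and \<open>Q\<close>, hence the average of its values at the single
      codewords, to which \<open>resolvent_binary_bound\<close> applies.\<close>
    also have "\<dots> = (1 / M) * (\<Sum>m<M. 2 * (c * p m + c' * (1 - p m)) - c\<^sup>2 * (q m + t * p m) - c'\<^sup>2 * ((1 - q m) + t * (1 - p m)))"
    proof -
      define \<alpha> where "\<alpha> = 2 * c' - c'\<^sup>2 * (1 + t)"
      define \<beta> where "\<beta> = 2 * c - 2 * c' - c\<^sup>2 * t + c'\<^sup>2 * t"
      define \<gamma> where "\<gamma> = c'\<^sup>2 - c\<^sup>2"
      have affine: "2 * (c * x + c' * (1 - x)) - c\<^sup>2 * (y + t * x) - c'\<^sup>2 * ((1 - y) + t * (1 - x)) = \<alpha> + \<beta> * x + \<gamma> * y" for x y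
        by (simp add: \<alpha>_def \<beta>_def \<gamma>_def algebra_simps)
      have "(\<Sum>m<M. \<alpha> + \<beta> * p m + \<gamma> * q m) = M * \<alpha> + \<beta> * (\<Sum>m<M. p m) + \<gamma> * (\<Sum>m<M. q m)"
        by (simp add: sum.distrib sum_distrib_left)
      thus ?thesis
        unfolding affine Pp Q_def using \<open>M > 0\<close> by (simp add: field_simps)
    qed
    also have "\<dots> \<le> (1 / M) * (\<Sum>m<M. \<Sum>i<N. \<Sum>j<N. (cmod (ip N (E m i) (F j)))\<^sup>2 * (r m i)\<^sup>2 / (s j + t * r m i))"
      unfolding p_def q_def
      using r F(2,3) t by (intro mult_left_mono sum_mono resolvent_binary_bound[OF E F(1) eff]) auto
    also have "\<dots> = (\<Sum>m<M. \<Sum>i<N. \<Sum>j<N. w m i j * r m i / (s j + t * r m i))"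
      by (simp add: w_def sum_distrib_left power2_eq_square mult_ac)
    also have "\<dots> = (\<Sum>k\<in>K. (case k of (m,i,j) \<Rightarrow> w m i j) * (case k of (m,i,j) \<Rightarrow> r m i)
        / ((case k of (m,i,j) \<Rightarrow> s j) + t * (case k of (m,i,j) \<Rightarrow> r m i)))"
      unfolding sumK[symmetric] by (intro sum.cong) auto
    finally show "(\<Sum>x\<in>L. w' x * w' x / (s' x + t * w' x)) \<le> \<dots>" .
  qed
  also have "(\<Sum>k\<in>K. (case k of (m,i,j) \<Rightarrow> w m i j) * (ln (case k of (m,i,j) \<Rightarrow> r m i) - ln (case k of (m,i,j) \<Rightarrow> s j)))
      = (\<Sum>(m,i,j)\<in>K. w m i j * ln (r m i)) - (\<Sum>(m,i,j)\<in>K. w m i j * ln (s j))"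
    unfolding sum_subtractf[symmetric] by (intro sum.cong) (auto simp: algebra_simps)
  also have "(\<Sum>(m,i,j)\<in>K. w m i j * ln (r m i)) = (\<Sum>m<M. \<Sum>i<N. (1 / M) * r m i * ln (r m i))"
    unfolding sumK sum_distrib_right[symmetric] by (intro sum.cong refl) (simp add: ri)
  also have "\<dots> = - ((1 / M) * (\<Sum>m<M. vN_entropy (D m)) * ln 2)"
  proof -
    have "(\<Sum>i<N. (1 / M) * r m i * ln (r m i)) = - ((1 / M) * (vN_entropy (D m) * ln 2))" if "m < M" for m
      using vN_entropy_ln[OF E[OF that]] r(1)[OF that] by (simp add: sum_distrib_left mult.assoc)
    thus ?thesis by (simp add: sum_negf sum_distrib_left sum_distrib_right mult.assoc)
  qed
  also have "(\<Sum>(m,i,j)\<in>K. w m i j * ln (s j)) = - (vN_entropy \<sigma> * ln 2)"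
    unfolding sumK swap3 vN_entropy_ln[OF F(1,2)] sum_distrib_right[symmetric]
    by (simp add: sj)
  finally have "P * ln P + (1 - P) * ln (1 - P) + P * ln M
      \<le> (vN_entropy \<sigma> - (1 / M) * (\<Sum>m<M. vN_entropy (D m))) * ln 2"
    using \<open>M > 0\<close> by (simp add: L_def w'_def s'_def ln_div algebra_simps)
  with binary_entropy_bound[OF P0 P1]
  have "P * ln M - ln 2 \<le> (vN_entropy \<sigma> - (1 / M) * (\<Sum>m<M. vN_entropy (D m))) * ln 2" by simp
  thus "P * log 2 M - 1 \<le> vN_entropy \<sigma> - (1 / M) * (\<Sum>m<M. vN_entropy (D m))"
    by (simp add: log_def field_simps)
qed

subsection \<open>Capacity and codes\<close>

lemma finite_words [simp]: "finite (words n :: 'a::finite list set)"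
  using finite_lists_length_eq[of "UNIV :: 'a set" n] by (simp add: words_def)

text \<open>\<open>x\<close> and the sequence in \<open>block_density\<close> need agree only on the
  sites 1 to \<open>n\<close>. The hybrid \<open>y\<close> follows \<open>x\<close> up to
  \<open>n\<close> and the other sequence afterwards: causality compares \<open>x\<close> with
  \<open>y\<close>, input memorylessness compares \<open>y\<close> with the other sequence.\<close>

lemma IMC_block_density:
  assumes "IMC W" "x \<in> cyl u" "length u = n"
  shows "W x 1 n = block_density W n u"
proof -
  define x' where "x' = (\<lambda>i. if 1 \<le> i \<and> i \<le> int n then u ! nat (i - 1) else undefined)"
  have eq: "x i = x' i" if "1 \<le> i" "i \<le> int n" for i
  proof -
    have "nat (i - 1) < length u" using assms(3) that by linarith
    hence "x (int (nat (i - 1)) + 1) = u ! nat (i - 1)"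
      using assms(2) unfolding cyl_def by blast
    moreover have "int (nat (i - 1)) + 1 = i" using that by simp
    ultimately show ?thesis using that by (simp add: x'_def)
  qed
  define y where "y = (\<lambda>i. if i \<le> int n then x i else x' i)"
  have "\<forall>i\<le>int n. x i = y i" by (simp add: y_def)
  hence "\<forall>m k. m + int k - 1 \<le> int n \<longrightarrow> W x m k = W y m k"
    using assms(1) unfolding IMC_def causal_def by blast
  hence "W x 1 n = W y 1 n" by simp
  also have "\<forall>i\<ge>1. y i = x' i" using eq by (simp add: y_def)
  hence "\<forall>m k. m \<ge> 1 \<longrightarrow> W y m k = W x' m k"
    using assms(1) unfolding IMC_def input_memoryless_def by blast
  hence "W y 1 n = W x' 1 n" by simp
  finally show ?thesis by (simp add: block_density_def x'_def)
qed

lemma cyl_nonempty: "cyl u \<noteq> {}"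
proof -
  have "(\<lambda>i. u ! nat (i - 1)) \<in> cyl u" by (simp add: cyl_def)
  thus ?thesis by blast
qed

text \<open>By \<open>IMC_block_density\<close> the error is constant on each cylinder, which is
  non-empty, so every supremum is over a singleton.\<close>

lemma avg_error_eq:
  assumes "IMC W" "\<And>m. m < M \<Longrightarrow> length (u m) = n" "M > 0"
  shows "avg_error W n M u b = 1 - (1 / M) * (\<Sum>m<M. Re (mtrace (block_density W n (u m) * b m)))"
proof -
  have "(SUP x\<in>cyl (u m). 1 - Re (mtrace (W x 1 n * b m))) = 1 - Re (mtrace (block_density W n (u m) * b m))"
    if "m < M" for m
  proof -
    have "(\<lambda>x. 1 - Re (mtrace (W x 1 n * b m))) ` cyl (u m) = {1 - Re (mtrace (block_density W n (u m) * b m))}"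
      using cyl_nonempty[of "u m"] IMC_block_density[OF assms(1) _ assms(2)[OF that]]
      by (auto simp: image_iff)
    thus ?thesis by simp
  qed
  hence "avg_error W n M u b = (1 / M) * (\<Sum>m<M. 1 - Re (mtrace (block_density W n (u m) * b m)))"
    by (simp add: avg_error_def)
  thus ?thesis
    using \<open>M > 0\<close> by (simp add: sum_subtractf right_diff_distrib)
qed

section \<open>Bounds on Holevo quantities and capacities\<close>

lemma block_density_density:
  assumes "cq_channel d W"
  shows "density (d ^ n) (block_density W n xs)"
  using assms unfolding cq_channel_def quasi_local_state_def block_density_def density_def by blast

text \<open>The subtracted average entropy is non-negative, and the output entropy is at most the
  logarithm of the dimension. This boundedness is needed before \<open>Sup\<close> in
  \<open>C_n\<close> and \<open>C_Holevo\<close> can be used as an upper bound.\<close>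

lemma holevo_chi_le:
  fixes W :: "(int \<Rightarrow> 'a::finite) \<Rightarrow> int \<Rightarrow> nat \<Rightarrow> complex mat"
  assumes "d > 0" "cq_channel d W" "is_distr n p"
  shows "holevo_chi d W n p \<le> n * log 2 d"
proof -
  note D = block_density_density[OF assms(2), of n]
  have p: "0 \<le> p xs" "(\<Sum>xs\<in>words n. p xs) = 1" for xs
    using assms(3) by (auto simp: is_distr_def)
  have "0 \<le> (\<Sum>xs\<in>words n. p xs * vN_entropy (block_density W n xs))"
    by (intro sum_nonneg mult_nonneg_nonneg p vN_entropy_nonneg[OF D])
  hence "holevo_chi d W n p \<le> log 2 (d ^ n)"
    using vN_entropy_le_log_dim[OF density_mixture[of "words n" "d ^ n" "block_density W n" p]] D p
    by (fastforce simp: holevo_chi_def)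
  thus ?thesis using \<open>d > 0\<close> by (simp add: log_nat_power)
qed

lemma holevo_chi_le_C_n:
  fixes W :: "(int \<Rightarrow> 'a::finite) \<Rightarrow> int \<Rightarrow> nat \<Rightarrow> complex mat"
  assumes "d > 0" "cq_channel d W" "is_distr n p"
  shows "holevo_chi d W n p \<le> C_n d W n"
  unfolding C_n_def
proof (rule cSup_upper)
  show "bdd_above {holevo_chi d W n p |p. is_distr n p}"
    using holevo_chi_le[OF assms(1,2)] unfolding bdd_above_def by blast
qed (use assms(3) in blast)

text \<open>For a deterministic input the mixture is the output density itself and the two entropies
  cancel. This makes the set in \<open>C_n\<close> non-empty and its supremum non-negative.\<close>

lemma point_mass:
  fixes W :: "(int \<Rightarrow> 'a::finite) \<Rightarrow> int \<Rightarrow> nat \<Rightarrow> complex mat"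
  assumes "cq_channel d W" "length xs = n"
  defines "p \<equiv> \<lambda>ys. of_bool (ys = xs)"
  shows "is_distr n p" and "holevo_chi d W n p = 0"
proof -
  have xs: "xs \<in> words n" using assms(2) by (simp add: words_def)
  have "block_density W n xs \<in> carrier_mat (d ^ n) (d ^ n)"
    using block_density_density[OF assms(1), of n xs] by (simp add: density_def psd_def)
  hence "Matrix.mat (d ^ n) (d ^ n) (\<lambda>(i,j). block_density W n xs $$ (i,j)) = block_density W n xs"
    by (intro eq_matI) auto
  thus "is_distr n p" "holevo_chi d W n p = 0"
    using xs by (auto simp: is_distr_def holevo_chi_def p_def of_bool_def if_distrib if_distribR cong: if_cong)
qed

lemma C_n_nonneg:
  fixes W :: "(int \<Rightarrow> 'a::finite) \<Rightarrow> int \<Rightarrow> nat \<Rightarrow> complex mat"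
  assumes "d > 0" "cq_channel d W"
  shows "0 \<le> C_n d W n"
  using holevo_chi_le_C_n[OF assms] point_mass[OF assms(2), of "replicate n undefined"]
  by (metis length_replicate)

lemma C_n_le_C_Holevo:
  fixes W :: "(int \<Rightarrow> 'a::finite) \<Rightarrow> int \<Rightarrow> nat \<Rightarrow> complex mat"
  assumes "d > 0" "cq_channel d W" "n \<ge> 1"
  shows "C_n d W n \<le> n * C_Holevo d W"
proof -
  have "C_n d W k \<le> k * log 2 d" for k
    unfolding C_n_def using point_mass(1)[OF assms(2), of "replicate k undefined"] holevo_chi_le[OF assms(1,2)]
    by (intro cSup_least) force+
  hence "bdd_above ((\<lambda>n. C_n d W n / n) ` {1..})"
    by (intro bdd_aboveI[of _ "log 2 d"]) (auto simp: field_simps)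
  hence "C_n d W n / n \<le> C_Holevo d W"
    unfolding C_Holevo_def using \<open>n \<ge> 1\<close> by (intro cSUP_upper) auto
  thus ?thesis using \<open>n \<ge> 1\<close> by (simp add: field_simps)
qed

section \<open>Empirical distribution of the codewords\<close>

definition empirical :: "nat \<Rightarrow> (nat \<Rightarrow> 'a) \<Rightarrow> 'a \<Rightarrow> real" where
  "empirical M u x = (1 / M) * (\<Sum>m<M. of_bool (u m = x))"

text \<open>Stated for real vector spaces in order to serve complex matrix entries and real
  entropies alike. Repeated codewords count with their multiplicity.\<close>

lemma sum_empirical:
  fixes f :: "'a \<Rightarrow> 'v::real_vector"
  assumes "finite X" "\<And>m. m < M \<Longrightarrow> u m \<in> X"
  shows "(\<Sum>x\<in>X. empirical M u x *\<^sub>R f x) = (\<Sum>m<M. (1 / M) *\<^sub>R f (u m))"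
proof -
  have "(\<Sum>x\<in>X. empirical M u x *\<^sub>R f x) = (\<Sum>x\<in>X. \<Sum>m<M. if x = u m then (1 / M) *\<^sub>R f x else 0)"
    unfolding empirical_def sum_distrib_left scaleR_sum_left by (intro sum.cong refl) auto
  also have "\<dots> = (\<Sum>m<M. \<Sum>x\<in>X. if x = u m then (1 / M) *\<^sub>R f x else 0)"
    by (rule sum.swap)
  also have "\<dots> = (\<Sum>m<M. (1 / M) *\<^sub>R f (u m))"
    using assms by (intro sum.cong refl) simp
  finally show ?thesis .
qed

lemma empirical_is_distr:
  fixes u :: "nat \<Rightarrow> 'a::finite list"
  assumes "\<And>m. m < M \<Longrightarrow> length (u m) = n" "M > 0"
  shows "is_distr n (empirical M u)"
  unfolding is_distr_def
proof (intro conjI allI)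
  fix xs show "0 \<le> empirical M u xs"
    unfolding empirical_def by (intro mult_nonneg_nonneg sum_nonneg) auto
next
  have "u m \<in> words n" if "m < M" for m using assms(1) that by (simp add: words_def)
  thus "(\<Sum>xs\<in>words n. empirical M u xs) = 1"
    using sum_empirical[of "words n" M u "\<lambda>_. 1::real"] \<open>M > 0\<close> by simp
qed

lemma holevo_chi_empirical:
  fixes W :: "(int \<Rightarrow> 'a::finite) \<Rightarrow> int \<Rightarrow> nat \<Rightarrow> complex mat"
  assumes "\<And>m. m < M \<Longrightarrow> length (u m) = n"
  shows "holevo_chi d W n (empirical M u)
    = vN_entropy (Matrix.mat (d ^ n) (d ^ n) (\<lambda>(i,j). \<Sum>m<M. complex_of_real (1 / M) * block_density W n (u m) $$ (i,j)))
      - (1 / M) * (\<Sum>m<M. vN_entropy (block_density W n (u m)))"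
proof -
  have u: "u m \<in> words n" if "m < M" for m using assms that by (simp add: words_def)
  have "(\<Sum>xs\<in>words n. complex_of_real (empirical M u xs) * f xs) = (\<Sum>m<M. complex_of_real (1 / M) * f (u m))" for f
    using sum_empirical[of "words n" M u f] u by (simp only: scaleR_conv_of_real finite_words)
  moreover have "(\<Sum>xs\<in>words n. empirical M u xs * f xs) = (1 / M) * (\<Sum>m<M. f (u m))" for f
    using sum_empirical[of "words n" M u f] u by (simp add: sum_distrib_left)
  ultimately show ?thesis unfolding holevo_chi_def by simp
qed

theorem theorem6:
  fixes W :: "(int \<Rightarrow> 'a::finite) \<Rightarrow> int \<Rightarrow> nat \<Rightarrow> complex mat"
    and d n M :: nat and u :: "nat \<Rightarrow> 'a list" and b :: "nat \<Rightarrow> complex mat" and \<epsilon> :: real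
  assumes "d > 0"
    and "cq_channel d W" and "stationary W" and "IMC W"
    and "\<epsilon> > 0"
    and "n \<ge> 1"
    and "is_code d n M u b"
    and "real M \<ge> 2 powr (real n * (C_Holevo d W + \<epsilon>))"
  shows "avg_error W n M u b \<ge> 1 - (C_Holevo d W + 1 / real n) / (C_Holevo d W + \<epsilon>)"
proof -
  define C where "C = C_Holevo d W"
  have code: "\<And>m. m < M \<Longrightarrow> length (u m) = n" "\<And>m. m < M \<Longrightarrow> psd (d ^ n) (b m)"
    "psd (d ^ n) (1\<^sub>m (d ^ n) - Matrix.mat (d ^ n) (d ^ n) (\<lambda>(r,c). \<Sum>i<M. b i $$ (r,c)))"
    using assms(7) by (auto simp: is_code_def)
  \<comment> \<open>The required size is positive, so there is a codeword and the averages with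
    factor \<open>1 / M\<close> make sense.\<close>
  have "0 < 2 powr (real n * (C + \<epsilon>))" by simp
  with assms(8) have "M > 0" unfolding C_def by (cases M) auto
  define P where "P = (1 / M) * (\<Sum>m<M. Re (mtrace (block_density W n (u m) * b m)))"
  note bound = success_probability_bound[OF \<open>M > 0\<close> block_density_density[OF assms(2)] code(2,3) refl P_def]
  have "P * log 2 M - 1 \<le> holevo_chi d W n (empirical M u)"
    by (subst holevo_chi_empirical, erule code(1), rule bound(2))
  also have "\<dots> \<le> C_n d W n"
    by (rule holevo_chi_le_C_n[OF assms(1,2) empirical_is_distr[OF code(1) \<open>M > 0\<close>]])
  also have "\<dots> \<le> n * C" unfolding C_def by (rule C_n_le_C_Holevo[OF assms(1,2,6)])
  finally have PC: "P * log 2 M \<le> n * C + 1" by simp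
  \<comment> \<open>Deterministic inputs give a non-negative capacity, which makes the denominator
    \<open>C + \<epsilon>\<close> positive.\<close>
  have "0 \<le> n * C" using C_n_nonneg[OF assms(1,2), of n] C_n_le_C_Holevo[OF assms(1,2,6)] by (simp add: C_def)
  hence "0 \<le> C" using \<open>n \<ge> 1\<close> by (simp add: zero_le_mult_iff)
  have "n * (C + \<epsilon>) \<le> log 2 M"
    using assms(8) \<open>M > 0\<close> by (simp add: C_def le_log_iff)
  hence "P * (n * (C + \<epsilon>)) \<le> P * log 2 M" using bound(1) by (rule mult_left_mono)
  with PC have "P * (n * (C + \<epsilon>)) \<le> n * C + 1" by simp
  also have "\<dots> = n * (C + 1 / n)" using \<open>n \<ge> 1\<close> by (simp add: field_simps)
  finally have "n * (P * (C + \<epsilon>)) \<le> n * (C + 1 / n)" by (simp only: mult.left_commute)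
  hence "P * (C + \<epsilon>) \<le> C + 1 / n" using \<open>n \<ge> 1\<close> by simp
  hence "P \<le> (C + 1 / n) / (C + \<epsilon>)"
    using \<open>0 \<le> C\<close> \<open>\<epsilon> > 0\<close> by (simp add: pos_le_divide_eq)
  moreover have "avg_error W n M u b = 1 - P"
    unfolding P_def by (rule avg_error_eq[OF assms(4) code(1) \<open>M > 0\<close>])
  ultimately show ?thesis by (simp add: C_def)
qed

end
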